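(* There exists an inverse system of abelian groups $\cdots \to A_{i+1} \to A_i \to \cdots \to A_1$ indexed by $\mathbb{N}$ such that all the maps $A_{i+1} \to A_i$ are epimorphisms and the kernel of the natural map $H_2(\varprojlim A_i) \to \varprojlim H_2(A_i)$ is not a cotorsion group.
   Context: $H_n(G) = H_n(G,\mathbb{Z})$ denotes the $n$-th group homology with integer coefficients. An abelian group $A$ is called a cotorsion group if $A \cong {\varprojlim}^1 B_i$ for some tower (inverse system indexed by $\mathbb{N}$) of abelian groups $B_i$; equivalently, if $\mathrm{Ext}(C,A)=0$ for every torsion-free abelian group $C$. *)

theory Defs
  imports "HOL-Algebra.Free_Abelian_Groups"
begin

section \<open>Group homology with integer coefficients\<close>

text \<open>
  Homology of the unnormalised inhomogeneous bar complex (the bar resolution tensored with the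
  trivial module). The basis element $[g_1|\dots|g_n]$ in degree $n$ is the list of its entries,
  and the boundary of $[g_1|\dots|g_n]$ is the alternating sum of its faces
  $[g_2|\dots|g_n]$, $[g_1|\dots|g_i g_{i+1}|\dots|g_n]$ for $0 < i < n$, and
  $[g_1|\dots|g_{n-1}]$.
\<close>

definition bar_chain_group :: "nat \<Rightarrow> ('a, 'm) monoid_scheme \<Rightarrow> ('a list \<Rightarrow>\<^sub>0 int) monoid"
  where "bar_chain_group n G = free_Abelian_group {xs. length xs = n \<and> set xs \<subseteq> carrier G}"

definition bar_face :: "('a, 'm) monoid_scheme \<Rightarrow> nat \<Rightarrow> 'a list \<Rightarrow> 'a list"
  where "bar_face G i xs =
    (if i = 0 then tl xs
     else if i = length xs then butlast xs
     else take (i - 1) xs @ [xs ! (i - 1) \<otimes>\<^bsub>G\<^esub> xs ! i] @ drop (i + 1) xs)"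

definition bar_boundary ::
    "('a, 'm) monoid_scheme \<Rightarrow> ('a list \<Rightarrow>\<^sub>0 int) \<Rightarrow> ('a list \<Rightarrow>\<^sub>0 int)"
  where "bar_boundary G = frag_extend (\<lambda>xs.
    if xs = [] then 0
    else (\<Sum>i\<le>length xs. frag_cmul ((-1) ^ i) (frag_of (bar_face G i xs))))"

definition bar_cycles :: "nat \<Rightarrow> ('a, 'm) monoid_scheme \<Rightarrow> ('a list \<Rightarrow>\<^sub>0 int) set"
  where "bar_cycles n G = {c \<in> carrier (bar_chain_group n G). bar_boundary G c = 0}"

definition bar_boundaries :: "nat \<Rightarrow> ('a, 'm) monoid_scheme \<Rightarrow> ('a list \<Rightarrow>\<^sub>0 int) set"
  where "bar_boundaries n G = bar_boundary G ` carrier (bar_chain_group (Suc n) G)"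

definition group_homology :: "nat \<Rightarrow> ('a, 'm) monoid_scheme \<Rightarrow> ('a list \<Rightarrow>\<^sub>0 int) set monoid"
  where "group_homology n G =
    (bar_chain_group n G)\<lparr>carrier := bar_cycles n G\<rparr> Mod bar_boundaries n G"

text \<open>
  The induced map sends the class of \<open>c\<close> to the class of \<open>f\<^sub># c\<close>; the image below is a singleton
  whenever \<open>f\<close> is a homomorphism from \<open>G\<close> to \<open>H\<close> and \<open>u\<close> is a homology class of \<open>G\<close>.
\<close>

definition group_homology_map ::
    "nat \<Rightarrow> ('b, 'n) monoid_scheme \<Rightarrow> ('a \<Rightarrow> 'b)
      \<Rightarrow> ('a list \<Rightarrow>\<^sub>0 int) set \<Rightarrow> ('b list \<Rightarrow>\<^sub>0 int) set"
  where "group_homology_map n H f u =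
    the_elem ((\<lambda>c. bar_boundaries n H #>\<^bsub>bar_chain_group n H\<^esub> frag_extend (frag_of \<circ> map f) c) ` u)"


section \<open>Towers of abelian groups\<close>

definition abelian_tower :: "(nat \<Rightarrow> ('a, 'm) monoid_scheme) \<Rightarrow> (nat \<Rightarrow> 'a \<Rightarrow> 'a) \<Rightarrow> bool"
  where "abelian_tower A f \<longleftrightarrow> (\<forall>i. comm_group (A i)) \<and> (\<forall>i. f i \<in> hom (A (Suc i)) (A i))"

definition tower_lim ::
    "(nat \<Rightarrow> ('a, 'm) monoid_scheme) \<Rightarrow> (nat \<Rightarrow> 'a \<Rightarrow> 'a) \<Rightarrow> (nat \<Rightarrow> 'a) monoid"
  where "tower_lim A f = (product_group UNIV A)
    \<lparr>carrier := {x \<in> carrier (product_group UNIV A). \<forall>i. f i (x (Suc i)) = x i}\<rparr>"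

definition homology_lim_map ::
    "nat \<Rightarrow> (nat \<Rightarrow> ('a, 'm) monoid_scheme)
      \<Rightarrow> ((nat \<Rightarrow> 'a) list \<Rightarrow>\<^sub>0 int) set \<Rightarrow> nat \<Rightarrow> ('a list \<Rightarrow>\<^sub>0 int) set"
  where "homology_lim_map n A u = (\<lambda>i. group_homology_map n (A i) (\<lambda>x. x i) u)"

definition tower_shift ::
    "(nat \<Rightarrow> ('a, 'm) monoid_scheme) \<Rightarrow> (nat \<Rightarrow> 'a \<Rightarrow> 'a) \<Rightarrow> (nat \<Rightarrow> 'a) \<Rightarrow> nat \<Rightarrow> 'a"
  where "tower_shift A f x = (\<lambda>i. x i \<otimes>\<^bsub>A i\<^esub> inv\<^bsub>A i\<^esub> (f i (x (Suc i))))"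

definition tower_lim1 ::
    "(nat \<Rightarrow> ('a, 'm) monoid_scheme) \<Rightarrow> (nat \<Rightarrow> 'a \<Rightarrow> 'a) \<Rightarrow> (nat \<Rightarrow> 'a) set monoid"
  where "tower_lim1 A f =
    product_group UNIV A Mod (tower_shift A f ` carrier (product_group UNIV A))"

text \<open>
  A definition cannot quantify over the type carrying the tower. The type chosen here is large
  enough: by \<open>cotorsion_group_if_iso_tower_lim1\<close> below, an abelian group that is isomorphic to
  $\varprojlim^1$ of a tower carried by any type whatsoever satisfies this definition.
\<close>

definition cotorsion_group :: "('a, 'm) monoid_scheme \<Rightarrow> bool"
  where "cotorsion_group K \<longleftrightarrow>
    (\<exists>(B :: nat \<Rightarrow> (nat \<Rightarrow> 'a \<Rightarrow>\<^sub>0 int) monoid) g. abelian_tower B g \<and> K \<cong> tower_lim1 B g)"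


section \<open>Independence of the type carrying the tower\<close>

lemma comm_group_product_group:
  assumes "\<And>i. i \<in> I \<Longrightarrow> comm_group (G i)"
  shows "comm_group (product_group I G)"
proof (rule group.group_comm_groupI)
  show "group (product_group I G)"
    using assms by (simp add: comm_group.axioms(2))
  fix x y assume "x \<in> carrier (product_group I G)" "y \<in> carrier (product_group I G)"
  then show "x \<otimes>\<^bsub>product_group I G\<^esub> y = y \<otimes>\<^bsub>product_group I G\<^esub> x"
    using assms by (auto simp: PiE_iff comm_group_def intro!: restrict_ext comm_monoid.m_comm)
qed

lemma tower_shift_hom:
  assumes "abelian_tower B g"
  shows "tower_shift B g \<in> hom (product_group UNIV B) (product_group UNIV B)"
proof (rule homI)
  have cg: "comm_group (B i)" and gh: "g i \<in> hom (B (Suc i)) (B i)" for i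
    using assms by (auto simp: abelian_tower_def)
  have gr: "group (B i)" for i
    using cg by (simp add: comm_group.axioms(2))
  have ghom: "group_hom (B (Suc i)) (B i) (g i)" for i
    using gr gh by (simp add: group_hom_def group_hom_axioms_def)
  fix x assume x: "x \<in> carrier (product_group UNIV B)"
  then have xi: "x i \<in> carrier (B i)" for i by auto
  show "tower_shift B g x \<in> carrier (product_group UNIV B)"
    using xi hom_in_carrier[OF gh] gr
    by (auto simp: tower_shift_def group.is_monoid intro!: monoid.m_closed group.inv_closed)
  fix y assume y: "y \<in> carrier (product_group UNIV B)"
  then have yi: "y i \<in> carrier (B i)" for i by auto
  show "tower_shift B g (x \<otimes>\<^bsub>product_group UNIV B\<^esub> y) =
      tower_shift B g x \<otimes>\<^bsub>product_group UNIV B\<^esub> tower_shift B g y"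
  proof
    fix i
    interpret comm_group "B i" by (rule cg)
    have c: "g i (x (Suc i)) \<in> carrier (B i)" "g i (y (Suc i)) \<in> carrier (B i)"
      using xi yi hom_in_carrier[OF gh] by auto
    have "g i (x (Suc i) \<otimes>\<^bsub>B (Suc i)\<^esub> y (Suc i)) = g i (x (Suc i)) \<otimes>\<^bsub>B i\<^esub> g i (y (Suc i))"
      using hom_mult[OF gh] xi yi by blast
    then show "tower_shift B g (x \<otimes>\<^bsub>product_group UNIV B\<^esub> y) i =
      (tower_shift B g x \<otimes>\<^bsub>product_group UNIV B\<^esub> tower_shift B g y) i"
      using c xi[of i] yi[of i] by (simp add: tower_shift_def inv_mult m_ac)
  qed
qed

lemma tower_shift_subgroup:
  assumes "abelian_tower B g"
  shows "subgroup (tower_shift B g ` carrier (product_group UNIV B)) (product_group UNIV B)"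
proof -
  have "group (product_group UNIV B)"
    using assms by (simp add: abelian_tower_def comm_group.axioms(2))
  then interpret group_hom "product_group UNIV B" "product_group UNIV B" "tower_shift B g"
    using tower_shift_hom[OF assms] by (simp add: group_hom_def group_hom_axioms_def)
  show ?thesis by (rule img_is_subgroup)
qed

lemma single_in_tower_shift:
  assumes "abelian_tower B g" "c \<in> carrier (B i)"
  shows "(\<lambda>j. if j = i then c else \<one>\<^bsub>B j\<^esub>) \<in> tower_shift B g ` carrier (product_group UNIV B)"
  using assms(2)
proof (induction i arbitrary: c)
  have cg: "comm_group (B i)" and gh: "g i \<in> hom (B (Suc i)) (B i)" for i
    using assms(1) by (auto simp: abelian_tower_def)
  have gr: "group (B i)" for i
    using cg by (simp add: comm_group.axioms(2))
  have g1: "g i \<one>\<^bsub>B (Suc i)\<^esub> = \<one>\<^bsub>B i\<^esub>" for i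
    using hom_one[OF gh gr gr] .
  have i1: "inv\<^bsub>B i\<^esub> \<one>\<^bsub>B i\<^esub> = \<one>\<^bsub>B i\<^esub>" and c1: "\<one>\<^bsub>B i\<^esub> \<in> carrier (B i)" for i
    using gr[of i] by (simp_all add: group.is_monoid monoid.inv_one)
  have l1: "\<one>\<^bsub>B i\<^esub> \<otimes>\<^bsub>B i\<^esub> c = c" "c \<otimes>\<^bsub>B i\<^esub> \<one>\<^bsub>B i\<^esub> = c" "inv\<^bsub>B i\<^esub> c \<otimes>\<^bsub>B i\<^esub> c = \<one>\<^bsub>B i\<^esub>"
      "inv\<^bsub>B i\<^esub> c \<in> carrier (B i)"
    if "c \<in> carrier (B i)" for i c
    using gr[of i] that by (simp_all add: group.is_monoid group.l_inv)
  have e: "(\<lambda>j. if j = i then c else \<one>\<^bsub>B j\<^esub>) \<in> carrier (product_group UNIV B)"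
    if "c \<in> carrier (B i)" for c i
    using that c1 by auto
  {
    case 0
    have "tower_shift B g (\<lambda>j. if j = 0 then c else \<one>\<^bsub>B j\<^esub>) = (\<lambda>j. if j = 0 then c else \<one>\<^bsub>B j\<^esub>)"
      using 0 by (auto simp: tower_shift_def g1 i1 l1 c1)
    then show ?case using imageI[OF e[OF 0], of "tower_shift B g"] by simp
  next
    case (Suc i)
    let ?P = "product_group UNIV B"
    let ?e = "\<lambda>i c. (\<lambda>j. if j = i then c else \<one>\<^bsub>B j\<^esub>)"
    have gc: "g i c \<in> carrier (B i)" using Suc.prems hom_in_carrier[OF gh] by blast
    have "tower_shift B g (?e (Suc i) c) \<otimes>\<^bsub>?P\<^esub> ?e i (g i c) = ?e (Suc i) c"
    proof
      fix j
      show "(tower_shift B g (?e (Suc i) c) \<otimes>\<^bsub>?P\<^esub> ?e i (g i c)) j = ?e (Suc i) c j"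
        using gc Suc.prems by (auto simp: tower_shift_def g1 i1 l1 c1)
    qed
    moreover have "tower_shift B g (?e (Suc i) c) \<otimes>\<^bsub>?P\<^esub> ?e i (g i c)
        \<in> tower_shift B g ` carrier ?P"
      using subgroup.m_closed[OF tower_shift_subgroup[OF assms(1)]] Suc.IH[OF gc]
        e[OF Suc.prems] by blast
    ultimately show ?case by (simp only:)
  }
qed

lemma cotorsion_group_if_epi:
  fixes K :: "('a, 'm) monoid_scheme" and \<psi> :: "(nat \<Rightarrow> 'a \<Rightarrow>\<^sub>0 int) \<Rightarrow> 'a"
  assumes K: "comm_group K"
    and \<psi>: "\<psi> \<in> epi (product_group UNIV (\<lambda>_. free_Abelian_group S)) K"
    and single: "\<And>i c. c \<in> carrier (free_Abelian_group S) \<Longrightarrow> \<psi> (\<lambda>j. if j = i then c else 0) = \<one>\<^bsub>K\<^esub>"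
  shows "cotorsion_group K"
proof -
  define F where "F = free_Abelian_group S"
  define P where "P = product_group (UNIV :: nat set) (\<lambda>_. F)"
  interpret F: comm_group F unfolding F_def by (rule abelian_free_Abelian_group)
  interpret P: comm_group P
    unfolding P_def by (rule comm_group_product_group) (rule F.comm_group_axioms)
  interpret K: comm_group K by (rule K)
  have \<psi>hom: "\<psi> \<in> hom P K" and \<psi>onto: "\<psi> ` carrier P = carrier K"
    using \<psi> by (auto simp: P_def F_def epi_def)
  interpret \<psi>: group_hom P K \<psi>
    by unfold_locales (rule \<psi>hom)
  have Pc: "x \<in> carrier P \<longleftrightarrow> (\<forall>i. x i \<in> carrier F)" for x
    by (auto simp: P_def)
  have Pm: "x \<otimes>\<^bsub>P\<^esub> y = (\<lambda>i. x i + y i)" for x y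
    by (auto simp: P_def F_def)
  have P1: "\<one>\<^bsub>P\<^esub> = (\<lambda>i. 0)"
    by (auto simp: P_def F_def)
  have Fadd: "a + b \<in> carrier F" if "a \<in> carrier F" "b \<in> carrier F" for a b
    using F.m_closed[OF that] by (simp add: F_def)
  have Fneg: "- a \<in> carrier F" if "a \<in> carrier F" for a
    using that by (simp add: F_def)
  have F0: "0 \<in> carrier F" by (simp add: F_def)
  have Fsum: "finite I \<Longrightarrow> (\<And>i. i \<in> I \<Longrightarrow> h i \<in> carrier F) \<Longrightarrow> sum h I \<in> carrier F" for h and I :: "nat set"
    by (induction I rule: finite_induct) (auto simp: Fadd F0 simp del: carrier_free_Abelian_group_iff)
  have Pi: "inv\<^bsub>P\<^esub> x = (\<lambda>i. - x i)" if "x \<in> carrier P" for x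
    by (rule P.inv_equality) (use that Fneg in \<open>auto simp: Pc Pm P1\<close>)
  define N where "N i = {x \<in> carrier P. \<psi> x = \<one>\<^bsub>K\<^esub> \<and> (\<forall>j<i. x j = 0)}" for i :: nat
  have Pm': "(x \<otimes>\<^bsub>P\<^esub> y) i = x i + y i" for x y i by (simp add: Pm)
  have P1': "\<one>\<^bsub>P\<^esub> i = 0" for i by (simp add: P1)
  have Pi': "(inv\<^bsub>P\<^esub> x) i = - x i" if "x \<in> carrier P" for x i by (simp add: Pi that)
  have Nsub: "subgroup (N i) P" for i
    by (rule subgroup.intro) (auto simp: N_def Pm' P1' Pi')
  have N0: "x \<in> N 0" if "x \<in> N i" for x i
    using that by (auto simp: N_def)
  define B where "B i = P\<lparr>carrier := N i\<rparr>" for i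
  define g where "g = (\<lambda>(i::nat) (x :: nat \<Rightarrow> 'a \<Rightarrow>\<^sub>0 int). x)"
  have Bc: "carrier (B i) = N i" and Bm: "x \<otimes>\<^bsub>B i\<^esub> y = x \<otimes>\<^bsub>P\<^esub> y" and B1: "\<one>\<^bsub>B i\<^esub> = \<one>\<^bsub>P\<^esub>" for i x y
    by (auto simp: B_def)
  have Binv: "inv\<^bsub>B i\<^esub> x = inv\<^bsub>P\<^esub> x" if "x \<in> N i" for x i
    unfolding B_def using P.m_inv_consistent[OF Nsub that] .
  have cB: "comm_group (B i)" for i
    proof (rule group.group_comm_groupI)
    show "group (B i)"
      unfolding B_def by (rule subgroup.subgroup_is_group[OF Nsub P.group_axioms])
    show "x \<otimes>\<^bsub>B i\<^esub> y = y \<otimes>\<^bsub>B i\<^esub> x" for x y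
      by (simp add: Bm Pm add.commute)
  qed
  have tower: "abelian_tower B g"
    using cB by (auto simp: abelian_tower_def g_def hom_def Bc Bm N_def)
  define Q where "Q = product_group UNIV B"
  interpret Q: comm_group Q
    unfolding Q_def by (rule comm_group_product_group) (rule cB)
  have Qc: "y \<in> carrier Q \<longleftrightarrow> (\<forall>i. y i \<in> N i)" for y
    by (auto simp: Q_def Bc)
  have Qm: "(y \<otimes>\<^bsub>Q\<^esub> z) i = y i \<otimes>\<^bsub>P\<^esub> z i" for y z i
    by (simp add: Q_def Bm)
  define s where "s y = (\<lambda>j. \<Sum>i\<le>j. y i j)" for y :: "nat \<Rightarrow> nat \<Rightarrow> 'a \<Rightarrow>\<^sub>0 int"
  have NF: "y i j \<in> carrier F" if "y \<in> carrier Q" for y i j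
    using that by (auto simp: Qc N_def Pc)
  have sP: "s y \<in> carrier P" if "y \<in> carrier Q" for y
    using NF[OF that] by (auto simp: Pc s_def intro!: Fsum)
  have s_mult: "s (y \<otimes>\<^bsub>Q\<^esub> z) = s y \<otimes>\<^bsub>P\<^esub> s z" for y z
    by (rule ext) (simp add: s_def Qm Pm' sum.distrib)
  define \<Theta> where "\<Theta> y = \<psi> (s y)" for y
  have \<Theta>hom: "\<Theta> \<in> hom Q K"
    by (rule homI) (auto simp: \<Theta>_def sP s_mult)
  interpret \<Theta>: group_hom Q K \<Theta>
    by unfold_locales (rule \<Theta>hom)
  have onto: "\<Theta> ` carrier Q = carrier K"
  proof
    show "\<Theta> ` carrier Q \<subseteq> carrier K" by auto
    show "carrier K \<subseteq> \<Theta> ` carrier Q"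
    proof
      fix a assume "a \<in> carrier K"
      then obtain p where p: "p \<in> carrier P" "a = \<psi> p" using \<psi>onto by blast
      define y where "y i = (\<lambda>j. if j = i then p i else 0)" for i :: nat
      have "y i \<in> N i" for i
        using p(1) single[of "p i" i] F0 by (auto simp: N_def y_def Pc F_def)
      then have "y \<in> carrier Q" by (simp add: Qc)
      moreover have "s y = p" by (rule ext) (simp add: s_def y_def)
      ultimately show "a \<in> \<Theta> ` carrier Q" using p(2) by (auto simp: \<Theta>_def)
    qed
  qed
  have shift: "tower_shift B g x i j = x i j - x (Suc i) j" if "x \<in> carrier Q" for x i j
  proof -
    have "x (Suc i) \<in> N (Suc i)" using that by (simp add: Qc)
    then have xs: "x (Suc i) \<in> N i" "x (Suc i) \<in> carrier P" by (auto simp: N_def)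
    then show ?thesis by (simp add: tower_shift_def g_def Bm Binv Pm' Pi')
  qed
  have ker: "kernel Q K \<Theta> = tower_shift B g ` carrier Q"
  proof
    show "tower_shift B g ` carrier Q \<subseteq> kernel Q K \<Theta>"
    proof (rule image_subsetI)
      fix x assume x: "x \<in> carrier Q"
      have "s (tower_shift B g x) = x 0"
      proof
        fix j
        have "s (tower_shift B g x) j = (\<Sum>i\<le>j. x i j - x (Suc i) j)"
          by (simp add: s_def shift[OF x])
        also have "\<dots> = x 0 j - x (Suc j) j"
          by (rule sum_telescope)
        also have "x (Suc j) j = 0" using x by (auto simp: Qc N_def)
        finally show "s (tower_shift B g x) j = x 0 j" by simp
      qed
      moreover have "\<psi> (x 0) = \<one>\<^bsub>K\<^esub>" using x by (auto simp: Qc N_def)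
      moreover have "tower_shift B g x \<in> carrier Q"
        using tower_shift_hom[OF tower] x unfolding Q_def[symmetric] by (rule hom_in_carrier)
      ultimately show "tower_shift B g x \<in> kernel Q K \<Theta>"
        by (simp add: kernel_def \<Theta>_def)
    qed
    show "kernel Q K \<Theta> \<subseteq> tower_shift B g ` carrier Q"
    proof
      fix y assume "y \<in> kernel Q K \<Theta>"
      then have y: "y \<in> carrier Q" and sy: "\<psi> (s y) = \<one>\<^bsub>K\<^esub>"
        by (auto simp: kernel_def \<Theta>_def)
      define x where "x i = (\<lambda>j. \<Sum>m\<in>{i..j}. y m j)" for i :: nat
      have yz: "y i j = 0" if "j < i" for i j using y that by (auto simp: Qc N_def)
      have step: "x i = x (Suc i) \<otimes>\<^bsub>P\<^esub> y i" for i
      proof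
        fix j show "x i j = (x (Suc i) \<otimes>\<^bsub>P\<^esub> y i) j"
          by (cases "i \<le> j") (simp_all add: x_def Pm' yz sum.atLeast_Suc_atMost)
      qed
      have xP: "x i \<in> carrier P" for i
        using NF[OF y] by (auto simp: Pc x_def intro!: Fsum)
      have yP: "y i \<in> carrier P" "\<psi> (y i) = \<one>\<^bsub>K\<^esub>" for i using y by (auto simp: Qc N_def)
      have "\<psi> (x i) = \<one>\<^bsub>K\<^esub>" for i
      proof (induction i)
        case 0
        have "x 0 = s y" by (rule ext) (simp add: x_def s_def atMost_atLeast0)
        then show ?case using sy by simp
      next
        case (Suc i)
        have "\<psi> (x i) = \<psi> (x (Suc i)) \<otimes>\<^bsub>K\<^esub> \<psi> (y i)"
          unfolding step[of i] by (rule \<psi>.hom_mult[OF xP yP(1)])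
        then show ?case using Suc yP(2) xP by simp
      qed
      then have xQ: "x \<in> carrier Q"
        using xP by (auto simp: Qc N_def) (simp add: x_def)
      have "tower_shift B g x = y"
      proof (intro ext)
        fix i j
        have "x i j = x (Suc i) j + y i j" using fun_cong[OF step[of i], of j] by (simp only: Pm')
        then show "tower_shift B g x i j = y i j" using shift[OF xQ] by simp
      qed
      then show "y \<in> tower_shift B g ` carrier Q" using xQ by blast
    qed
  qed
  have L: "tower_lim1 B g = Q Mod kernel Q K \<Theta>"
    unfolding ker by (simp only: tower_lim1_def Q_def)
  have "tower_lim1 B g \<cong> K"
    unfolding L by (rule \<Theta>.FactGroup_iso[OF onto])
  moreover have "group (tower_lim1 B g)"
    unfolding L by (rule normal.factorgroup_is_group[OF \<Theta>.normal_kernel])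
  ultimately have "K \<cong> tower_lim1 B g"
    using group.iso_sym by blast
  then show ?thesis unfolding cotorsion_group_def using tower by blast
qed

lemma cotorsion_group_if_iso_tower_lim1:
  fixes K :: "('a, 'm) monoid_scheme" and B :: "nat \<Rightarrow> ('b, 'n) monoid_scheme"
  assumes K: "comm_group K" and tower: "abelian_tower B g" and iso: "K \<cong> tower_lim1 B g"
  shows "cotorsion_group K"
proof -
  define Q where "Q = product_group UNIV B"
  define D where "D = tower_shift B g ` carrier Q"
  define F where "F = free_Abelian_group (carrier K)"
  define P where "P = product_group (UNIV :: nat set) (\<lambda>_. F)"
  interpret K: comm_group K by (rule K)
  interpret F: comm_group F unfolding F_def by (rule abelian_free_Abelian_group)
  interpret Q: comm_group Q
    unfolding Q_def by (rule comm_group_product_group) (use tower in \<open>simp add: abelian_tower_def\<close>)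
  have Dsub: "subgroup D Q"
    unfolding D_def Q_def by (rule tower_shift_subgroup[OF tower])
  then have Dn: "D \<lhd> Q" by (simp add: Q.normal_iff_subgroup)
  have L: "tower_lim1 B g = Q Mod D" by (simp add: tower_lim1_def D_def Q_def)
  obtain h where h: "h \<in> iso (Q Mod D) K"
    using K.iso_sym[OF iso] unfolding L is_iso_def by blast
  define \<pi> where "\<pi> x = h (D #>\<^bsub>Q\<^esub> x)" for x
  have \<pi>hom: "\<pi> \<in> hom Q K"
    unfolding \<pi>_def using hom_compose[OF normal.r_coset_hom_Mod[OF Dn], of h K] h
    by (simp add: iso_def o_def)
  have \<pi>onto: "\<pi> ` carrier Q = carrier K"
  proof -
    have "carrier (Q Mod D) = (\<lambda>x. D #>\<^bsub>Q\<^esub> x) ` carrier Q"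
      by (auto simp: FactGroup_def RCOSETS_def)
    then have "\<pi> ` carrier Q = h ` carrier (Q Mod D)"
      by (auto simp: \<pi>_def)
    then show ?thesis using h by (auto simp: iso_def bij_betw_def)
  qed
  have \<pi>D: "\<pi> x = \<one>\<^bsub>K\<^esub>" if "x \<in> D" for x
  proof -
    have "h D = \<one>\<^bsub>K\<^esub>"
      using hom_one[of h "Q Mod D" K] h normal.factorgroup_is_group[OF Dn] K.group_axioms
      by (simp add: iso_def)
    then show ?thesis
      using Q.coset_join2[of x D] that Dsub subgroup.mem_carrier[OF Dsub] by (simp add: \<pi>_def)
  qed
  define b where "b = inv_into (carrier Q) \<pi>"
  have b: "b a \<in> carrier Q" "\<pi> (b a) = a" if "a \<in> carrier K" for a
    using that inv_into_into[of a \<pi> "carrier Q"] f_inv_into_f[of a \<pi> "carrier Q"]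
    by (simp_all add: b_def \<pi>onto)
  obtain \<beta> where \<beta>: "\<beta> \<in> hom F Q" "\<And>a. a \<in> carrier K \<Longrightarrow> \<beta> (frag_of a) = b a"
    using Q.free_Abelian_group_universal[of b "carrier K"] b(1) unfolding F_def by blast
  define \<phi> where "\<phi> x = (\<lambda>i. \<beta> (x i) i)" for x :: "nat \<Rightarrow> 'a \<Rightarrow>\<^sub>0 int"
  have Pc: "x \<in> carrier P \<longleftrightarrow> (\<forall>i. x i \<in> carrier F)" for x
    by (auto simp: P_def)
  have \<beta>c: "\<beta> c i \<in> carrier (B i)" if "c \<in> carrier F" for c i
    using hom_in_carrier[OF \<beta>(1) that] by (auto simp: Q_def)
  have \<phi>c: "\<phi> x \<in> carrier Q" if "x \<in> carrier P" for x
    using that \<beta>c by (auto simp: \<phi>_def Pc Q_def)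
  have \<phi>hom: "\<phi> \<in> hom P Q"
  proof (rule homI)
    fix x y assume xy: "x \<in> carrier P" "y \<in> carrier P"
    show "\<phi> (x \<otimes>\<^bsub>P\<^esub> y) = \<phi> x \<otimes>\<^bsub>Q\<^esub> \<phi> y"
    proof
      fix i
      have "\<beta> (x i \<otimes>\<^bsub>F\<^esub> y i) = \<beta> (x i) \<otimes>\<^bsub>Q\<^esub> \<beta> (y i)"
        using hom_mult[OF \<beta>(1)] xy by (simp add: Pc)
      then show "\<phi> (x \<otimes>\<^bsub>P\<^esub> y) i = (\<phi> x \<otimes>\<^bsub>Q\<^esub> \<phi> y) i"
        by (simp add: \<phi>_def P_def Q_def)
    qed
  qed (rule \<phi>c)
  define \<psi> where "\<psi> = \<pi> \<circ> \<phi>"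
  have \<psi>hom: "\<psi> \<in> hom P K"
    unfolding \<psi>_def by (rule hom_compose[OF \<phi>hom \<pi>hom])
  have "\<psi> \<in> epi P K"
    unfolding epi_iff_subset
  proof (intro conjI \<psi>hom subsetI)
    fix a assume a: "a \<in> carrier K"
    have "(\<lambda>_. frag_of a) \<in> carrier P" using a by (simp add: Pc F_def)
    moreover have "\<psi> (\<lambda>_. frag_of a) = a"
      using a \<beta>(2) b(2) by (simp add: \<psi>_def \<phi>_def)
    ultimately show "a \<in> \<psi> ` carrier P" by (metis imageI)
  qed
  moreover have "\<psi> (\<lambda>j. if j = i then c else 0) = \<one>\<^bsub>K\<^esub>" if c: "c \<in> carrier F" for i c
  proof -
    have "\<beta> 0 = \<one>\<^bsub>Q\<^esub>"
      using hom_one[OF \<beta>(1) F.group_axioms Q.group_axioms] by (simp add: F_def)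
    then have "\<phi> (\<lambda>j. if j = i then c else 0) = (\<lambda>j. if j = i then \<beta> c i else \<one>\<^bsub>B j\<^esub>)"
      by (auto simp: \<phi>_def Q_def)
    also have "\<dots> \<in> D"
      unfolding D_def Q_def by (rule single_in_tower_shift[OF tower \<beta>c[OF c]])
    finally show ?thesis using \<pi>D by (simp add: \<psi>_def)
  qed
  ultimately show ?thesis
    using cotorsion_group_if_epi[OF K, of \<psi> "carrier K"] unfolding P_def F_def by blast
qed

end

theory Submission
  imports Defs "HOL-Algebra.Multiplicative_Group" "HOL-Algebra.Weak_Morphisms"
begin

text \<open>
  Take $A_i = \mathbb{Z}/2^i \oplus C$ for a torsion 2-group $C$, so that
  $\varprojlim A_i = \mathbb{Z}_2 \oplus C$. For $x, y$ in an abelian group the class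
  $\langle x, y\rangle$ of $[x|y] - [y|x]$ in $H_2$ is bilinear. If $b$ generates $\mathbb{Z}_2$
  and $c \in \bigcap_i 2^i C$, then $\langle b, c\rangle$ dies in every $H_2(A_i)$, since there
  $2^i b = 0$ while $c$ is divisible by $2^i$. If the kernel were cotorsion, the equations
  $x_n = 2 x_{n+1} + \langle b, c_n\rangle$ would have a solution in it. The bilinear map
  $(x, y) \mapsto x_{\mathbb{Z}_2} \cdot y_C$ is a 2-cocycle and carries this solution to a solution
  of $u_n = 2 u_{n+1} + c_n$ in $C$. Now choose $C$ such that its first Ulm subgroup
  $\bigcap_i 2^i C$ is $\bigoplus_n \mathbb{Z}/2^{n+1}$, with generators $c_n$. All $u_n$ lie in this
  subgroup, so the component of $u_0$ at each $n$ is $2^n c_n \neq 0$, contradicting finite support.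
\<close>


section \<open>Recurrences in cotorsion groups\<close>

lemma abelian_tower_comm_group: "abelian_tower A f \<Longrightarrow> comm_group (A i)"
  and abelian_tower_hom: "abelian_tower A f \<Longrightarrow> f i \<in> hom (A (Suc i)) (A i)"
  by (simp_all add: abelian_tower_def)

lemma comm_group_imp_monoid: "comm_group G \<Longrightarrow> monoid G"
  by (simp add: comm_group_def comm_monoid_def)

lemmas abelian_tower_monoid = comm_group_imp_monoid[OF abelian_tower_comm_group]

text \<open>
  For abelian $G$, solvability for all \<open>k\<close> means $\mathrm{Ext}(M, G) = 0$ for the colimit $M$ of
  $\mathbb{Z} \xrightarrow{m_0} \mathbb{Z} \xrightarrow{m_1} \cdots$, a torsion-free group if all
  $m_n \neq 0$.
\<close>

definition recurrence_solvable :: "('a, 'm) monoid_scheme \<Rightarrow> (nat \<Rightarrow> nat) \<Rightarrow> (nat \<Rightarrow> 'a) \<Rightarrow> bool"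
  where "recurrence_solvable G m k \<longleftrightarrow>
    (\<exists>x. \<forall>n. x n \<in> carrier G \<and> x n = x (Suc n) [^]\<^bsub>G\<^esub> m n \<otimes>\<^bsub>G\<^esub> k n)"

lemma recurrence_solvableI:
  assumes "\<And>n. x n \<in> carrier G" and "\<And>n. x n = x (Suc n) [^]\<^bsub>G\<^esub> m n \<otimes>\<^bsub>G\<^esub> k n"
  shows "recurrence_solvable G m k"
  unfolding recurrence_solvable_def using assms by blast

lemma recurrence_solvableE:
  assumes "recurrence_solvable G m k"
  obtains x where "\<And>n. x n \<in> carrier G" and "\<And>n. x n = x (Suc n) [^]\<^bsub>G\<^esub> m n \<otimes>\<^bsub>G\<^esub> k n"
  using assms unfolding recurrence_solvable_def by blast

lemma recurrence_solvable_hom: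
  assumes h: "group_hom G H h" and k: "\<And>n. k n \<in> carrier G" and "recurrence_solvable G m k"
  shows "recurrence_solvable H m (\<lambda>n. h (k n))"
proof -
  interpret group_hom G H h by (rule h)
  from assms(3) obtain x where x: "\<And>n. x n \<in> carrier G"
    and x_eq: "\<And>n. x n = x (Suc n) [^]\<^bsub>G\<^esub> m n \<otimes>\<^bsub>G\<^esub> k n"
    by (rule recurrence_solvableE) blast
  show ?thesis
  proof (rule recurrence_solvableI[of "\<lambda>n. h (x n)"])
    fix n
    show "h (x n) \<in> carrier H" by (rule hom_closed[OF x])
    have "h (x n) = h (x (Suc n) [^]\<^bsub>G\<^esub> m n \<otimes>\<^bsub>G\<^esub> k n)"
      by (rule arg_cong[OF x_eq])
    also have "\<dots> = h (x (Suc n)) [^]\<^bsub>H\<^esub> m n \<otimes>\<^bsub>H\<^esub> h (k n)"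
      using x k by (simp add: hom_nat_pow)
    finally show "h (x n) = h (x (Suc n)) [^]\<^bsub>H\<^esub> m n \<otimes>\<^bsub>H\<^esub> h (k n)" .
  qed
qed

lemma (in monoid) recurrence_solvable_if_eventually_one:
  assumes "\<And>n. k n \<in> carrier G" and "\<And>n. N \<le> n \<Longrightarrow> k n = \<one>"
  shows "recurrence_solvable G m k"
  using assms
proof (induction N arbitrary: m k)
  case 0
  then show ?case
    by (intro recurrence_solvableI[of "\<lambda>_. \<one>"]) simp_all
next
  case (Suc N)
  have "recurrence_solvable G (\<lambda>n. m (Suc n)) (\<lambda>n. k (Suc n))"
    by (rule Suc.IH) (simp_all add: Suc.prems)
  then obtain x where x: "\<And>n. x n \<in> carrier G"
    and x_eq: "\<And>n. x n = x (Suc n) [^] m (Suc n) \<otimes> k (Suc n)"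
    by (rule recurrence_solvableE) blast
  let ?x = "case_nat (x 0 [^] m 0 \<otimes> k 0) x"
  show ?case
  proof (rule recurrence_solvableI[of ?x])
    show "?x n \<in> carrier G" for n
      using x Suc.prems(1) by (cases n) simp_all
    show "?x n = ?x (Suc n) [^] m n \<otimes> k n" for n
    proof (cases n)
      case (Suc l)
      show ?thesis unfolding Suc nat.case by (rule x_eq)
    qed simp
  qed
qed

lemma nat_pow_product_group:
  "i \<in> I \<Longrightarrow> (x [^]\<^bsub>product_group I G\<^esub> (n :: nat)) i = x i [^]\<^bsub>G i\<^esub> n"
  by (induction n) (simp_all add: nat_pow_def)

lemma recurrence_solvable_product_group:
  assumes G: "\<And>i. monoid (G i)" and k: "\<And>n. k n \<in> carrier (product_group UNIV G)"
    and k_one: "\<And>n i. i < n \<Longrightarrow> k n i = \<one>\<^bsub>G i\<^esub>"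
  shows "recurrence_solvable (product_group UNIV G) m k"
proof -
  have "recurrence_solvable (G i) m (\<lambda>n. k n i)" for i
    by (rule monoid.recurrence_solvable_if_eventually_one[OF G, where N = "Suc i"])
      (use k k_one in auto)
  then obtain x where x: "\<And>i n. x i n \<in> carrier (G i)"
    and x_eq: "\<And>i n. x i n = x i (Suc n) [^]\<^bsub>G i\<^esub> m n \<otimes>\<^bsub>G i\<^esub> k n i"
    unfolding recurrence_solvable_def by metis
  show ?thesis
  proof (rule recurrence_solvableI[of "\<lambda>n i. x i n"])
    fix n
    show "(\<lambda>i. x i n) \<in> carrier (product_group UNIV G)"
      using x by auto
    show "(\<lambda>i. x i n) = (\<lambda>i. x i (Suc n)) [^]\<^bsub>product_group UNIV G\<^esub> m n \<otimes>\<^bsub>product_group UNIV G\<^esub> k n"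
      using x_eq[of _ n] by (simp add: fun_eq_iff nat_pow_product_group)
  qed
qed

lemma comm_group_product_tower:
  "abelian_tower B g \<Longrightarrow> comm_group (product_group UNIV B)"
  by (simp add: abelian_tower_def comm_group_product_group)

lemma tower_shift_normal:
  assumes "abelian_tower B g"
  shows "tower_shift B g ` carrier (product_group UNIV B) \<lhd> product_group UNIV B"
  using comm_group.subgroup_imp_normal[OF comm_group_product_tower tower_shift_subgroup] assms
  by blast

lemma comm_group_tower_lim1:
  assumes "abelian_tower B g"
  shows "comm_group (tower_lim1 B g)"
  unfolding tower_lim1_def
  using comm_group.abelian_FactGroup[OF comm_group_product_tower tower_shift_subgroup] assms
  by blast

lemma truncation_in_tower_shift:
  assumes tower: "abelian_tower B g" and q: "\<And>i. q i \<in> carrier (B i)"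
  shows "(\<lambda>i. if i < n then q i else \<one>\<^bsub>B i\<^esub>) \<in> tower_shift B g ` carrier (product_group UNIV B)"
proof (induction n)
  case 0
  show ?case
    using subgroup.one_closed[OF tower_shift_subgroup[OF tower]] by (simp add: restrict_def)
next
  case (Suc n)
  note B = abelian_tower_monoid[OF tower]
  have "(\<lambda>i. if i < Suc n then q i else \<one>\<^bsub>B i\<^esub>) =
      (\<lambda>i. if i < n then q i else \<one>\<^bsub>B i\<^esub>) \<otimes>\<^bsub>product_group UNIV B\<^esub>
      (\<lambda>i. if i = n then q n else \<one>\<^bsub>B i\<^esub>)"
    using q B by (auto simp: fun_eq_iff less_Suc_eq monoid.r_one monoid.l_one)
  then show ?case
    using subgroup.m_closed[OF tower_shift_subgroup[OF tower] Suc.IH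
        single_in_tower_shift[OF tower q]] by simp
qed

lemma tower_lim1_tail_representative:
  fixes B :: "nat \<Rightarrow> ('a, 'm) monoid_scheme" and g :: "nat \<Rightarrow> 'a \<Rightarrow> 'a" and n :: nat
  defines "P \<equiv> product_group UNIV B" and "D \<equiv> tower_shift B g ` carrier (product_group UNIV B)"
  assumes tower: "abelian_tower B g" and q: "q \<in> carrier P"
  shows "\<exists>q' \<in> carrier P. (\<forall>i<n. q' i = \<one>\<^bsub>B i\<^esub>) \<and> D #>\<^bsub>P\<^esub> q' = D #>\<^bsub>P\<^esub> q"
proof -
  interpret P: comm_group P
    unfolding P_def by (rule comm_group_product_tower[OF tower])
  have D: "subgroup D P"
    unfolding D_def P_def by (rule tower_shift_subgroup[OF tower])
  note B = abelian_tower_monoid[OF tower]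
  have q_in: "q i \<in> carrier (B i)" for i using q by (auto simp: P_def)
  define d where "d = (\<lambda>i. if i < n then q i else \<one>\<^bsub>B i\<^esub>)"
  define q' where "q' = (\<lambda>i. if i < n then \<one>\<^bsub>B i\<^esub> else q i)"
  have d: "d \<in> D"
    unfolding D_def d_def by (rule truncation_in_tower_shift[OF tower q_in])
  have q': "q' \<in> carrier P"
    using q_in B by (auto simp: P_def q'_def monoid.one_closed)
  have "q = d \<otimes>\<^bsub>P\<^esub> q'"
    using q_in B by (auto simp: fun_eq_iff P_def d_def q'_def monoid.r_one monoid.l_one)
  then have "D #>\<^bsub>P\<^esub> q = D #>\<^bsub>P\<^esub> (d \<otimes>\<^bsub>P\<^esub> q')" by simp
  also have "\<dots> = (D #>\<^bsub>P\<^esub> d) #>\<^bsub>P\<^esub> q'"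
    using subgroup.subset[OF D] subgroup.mem_carrier[OF D d] q' by (simp add: P.coset_mult_assoc)
  also have "\<dots> = D #>\<^bsub>P\<^esub> q'"
    using P.coset_join2[OF subgroup.mem_carrier[OF D d] D d] by simp
  finally have "D #>\<^bsub>P\<^esub> q' = D #>\<^bsub>P\<^esub> q" by simp
  with q' show ?thesis by (intro bexI[of _ q']) (simp_all add: q'_def)
qed

text \<open>
  An element of $\varprojlim^1$ has representatives that are trivial below any given level, so that
  only finitely many terms matter in each coordinate.
\<close>

lemma recurrence_solvable_tower_lim1:
  assumes tower: "abelian_tower B g" and k: "\<And>n. k n \<in> carrier (tower_lim1 B g)"
  shows "recurrence_solvable (tower_lim1 B g) m k"
proof -
  define P where "P = product_group UNIV B"
  define L where "L = tower_lim1 B g"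
  define coset where "coset q = (tower_shift B g ` carrier P) #>\<^bsub>P\<^esub> q" for q
  have L_Mod: "L = P Mod tower_shift B g ` carrier P"
    by (simp add: L_def P_def tower_lim1_def)
  have coset_hom: "group_hom P L coset"
    unfolding group_hom_def group_hom_axioms_def
    using normal.r_coset_hom_Mod[OF tower_shift_normal[OF tower]]
      comm_group_product_tower[OF tower] comm_group_tower_lim1[OF tower]
    by (simp add: L_Mod coset_def[abs_def] P_def tower_lim1_def comm_group.axioms(2))
  have "\<exists>q. q \<in> carrier P \<and> (\<forall>i<n. q i = \<one>\<^bsub>B i\<^esub>) \<and> coset q = k n" for n
  proof -
    obtain q where "q \<in> carrier P" "k n = coset q"
      using k[of n] by (auto simp: L_Mod carrier_FactGroup coset_def simp flip: L_def)
    then show ?thesis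
      using tower_lim1_tail_representative[OF tower, of q n] by (auto simp: P_def coset_def)
  qed
  then have "\<forall>n. \<exists>q. q \<in> carrier P \<and> (\<forall>i<n. q i = \<one>\<^bsub>B i\<^esub>) \<and> coset q = k n" ..
  from choice[OF this] obtain q
    where q: "\<forall>n. q n \<in> carrier P \<and> (\<forall>i<n. q n i = \<one>\<^bsub>B i\<^esub>) \<and> coset (q n) = k n" ..
  have "recurrence_solvable P m q"
    unfolding P_def
    by (rule recurrence_solvable_product_group[OF abelian_tower_monoid[OF tower]])
      (use q in \<open>simp_all add: P_def\<close>)
  then have "recurrence_solvable L m (\<lambda>n. coset (q n))"
    using q by (intro recurrence_solvable_hom[OF coset_hom]) auto
  with q show ?thesis by (simp add: L_def)
qed

lemma recurrence_solvable_cotorsion_group: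
  fixes K :: "('a, 'm) monoid_scheme"
  assumes K: "group K" "cotorsion_group K" and k: "\<And>n. k n \<in> carrier K"
  shows "recurrence_solvable K m k"
proof -
  obtain B :: "nat \<Rightarrow> (nat \<Rightarrow> 'a \<Rightarrow>\<^sub>0 int) monoid" and g h
    where tower: "abelian_tower B g" and h: "h \<in> iso K (tower_lim1 B g)"
    using K(2) by (auto simp: cotorsion_group_def is_iso_def)
  let ?h' = "inv_into (carrier K) h"
  have "?h' \<in> iso (tower_lim1 B g) K"
    by (rule group.iso_set_sym[OF K(1) h])
  then have h'_hom: "group_hom (tower_lim1 B g) K ?h'"
    using K(1) comm_group_tower_lim1[OF tower]
    by (simp add: group_hom_def group_hom_axioms_def iso_imp_homomorphism comm_group.axioms(2))
  have h_in: "h (k n) \<in> carrier (tower_lim1 B g)" and h'_h: "?h' (h (k n)) = k n" for n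
    using h k by (auto simp: iso_def hom_def bij_betw_def)
  have "recurrence_solvable K m (\<lambda>n. ?h' (h (k n)))"
    by (rule recurrence_solvable_hom[OF h'_hom h_in recurrence_solvable_tower_lim1[OF tower h_in]])
  then show ?thesis by (simp only: h'_h)
qed


subsection \<open>Infinitely divisible elements\<close>

definition infinitely_divisible :: "('a, 'm) monoid_scheme \<Rightarrow> nat \<Rightarrow> 'a \<Rightarrow> bool"
  where "infinitely_divisible G p c \<longleftrightarrow> (\<forall>i. \<exists>y \<in> carrier G. c = y [^]\<^bsub>G\<^esub> (p ^ i))"

lemma infinitely_divisible_closed:
  assumes "group G" "infinitely_divisible G p c"
  shows "c \<in> carrier G"
proof -
  interpret group G by (rule assms(1))
  obtain y where "y \<in> carrier G" "c = y [^]\<^bsub>G\<^esub> (p ^ 0)"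
    using assms(2) unfolding infinitely_divisible_def by blast
  then show ?thesis by simp
qed

lemma infinitely_divisible_if_recurrence:
  fixes G (structure)
  assumes G: "comm_group G" and k: "\<And>n. infinitely_divisible G p (k n)"
    and x: "\<And>n. x n \<in> carrier G" and x_eq: "\<And>n. x n = x (Suc n) [^]\<^bsub>G\<^esub> p \<otimes>\<^bsub>G\<^esub> k n"
  shows "infinitely_divisible G p (x n)"
proof -
  interpret comm_group G by (rule G)
  have "\<exists>y \<in> carrier G. x n = y [^] (p ^ i)" for i
  proof (induction i arbitrary: n)
    case 0
    show ?case using x by (intro bexI[of _ "x n"]) simp_all
  next
    case (Suc i)
    obtain y z where y: "y \<in> carrier G" "x (Suc n) = y [^] (p ^ i)"
      and z: "z \<in> carrier G" "k n = z [^] (p ^ Suc i)"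
      using Suc.IH k unfolding infinitely_divisible_def by blast
    have "x n = (y [^] (p ^ i)) [^] p \<otimes> z [^] (p ^ Suc i)"
      unfolding x_eq[of n] y(2) z(2) ..
    also have "\<dots> = (y \<otimes> z) [^] (p ^ Suc i)"
      using y(1) z(1) by (simp add: nat_pow_distrib nat_pow_pow mult.commute)
    finally show ?case using y(1) z(1) by blast
  qed
  then show ?thesis by (simp add: infinitely_divisible_def)
qed


section \<open>The bar complex\<close>

lemma comm_group_bar_chain_group: "comm_group (bar_chain_group n G)"
  by (simp add: bar_chain_group_def abelian_free_Abelian_group)

lemma length_bar_face: "i \<le> length xs \<Longrightarrow> length (bar_face G i xs) = length xs - 1"
  by (auto simp: bar_face_def)

lemma nth_bar_face:
  assumes "i \<le> length xs" "Suc k < length xs"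
  shows "bar_face G i xs ! k =
    (if Suc k < i then xs ! k else if Suc k = i then xs ! k \<otimes>\<^bsub>G\<^esub> xs ! Suc k else xs ! Suc k)"
  using assms
  by (auto simp: bar_face_def nth_tl nth_butlast nth_append min_def nth_Cons' Suc_diff_le)

lemma bar_face_bar_face:
  assumes G: "monoid G" and xs: "set xs \<subseteq> carrier G" and ij: "i \<le> j" "Suc j \<le> length xs"
  shows "bar_face G i (bar_face G (Suc j) xs) = bar_face G j (bar_face G i xs)"
proof (rule nth_equalityI)
  define entry where "entry i u k =
    (if Suc k < i then u k else if Suc k = i then u k \<otimes>\<^bsub>G\<^esub> u (Suc k) else u (Suc k))"
    for i k and u :: "nat \<Rightarrow> 'a"
  have nth_face: "bar_face G i ys ! k = entry i ((!) ys) k"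
    if "i \<le> length ys" "Suc k < length ys" for i ys k
    using that by (simp add: nth_bar_face entry_def)
  fix k assume "k < length (bar_face G i (bar_face G (Suc j) xs))"
  then have k: "Suc (Suc k) < length xs"
    using ij by (simp add: length_bar_face)
  then have mem: "xs ! k \<in> carrier G" "xs ! Suc k \<in> carrier G" "xs ! Suc (Suc k) \<in> carrier G"
    using xs by (auto simp: subset_iff)
  have "bar_face G i (bar_face G (Suc j) xs) ! k = entry i ((!) (bar_face G (Suc j) xs)) k"
    using ij k by (intro nth_face) (auto simp: length_bar_face)
  also have "\<dots> = entry i (entry (Suc j) ((!) xs)) k"
    using ij k by (simp add: entry_def[of i] nth_face)
  also have "\<dots> = entry j (entry i ((!) xs)) k"
    using ij mem by (auto simp: entry_def monoid.m_assoc[OF G])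
  also have "\<dots> = entry j ((!) (bar_face G i xs)) k"
    using ij k by (simp add: entry_def[of j] nth_face)
  also have "\<dots> = bar_face G j (bar_face G i xs) ! k"
    using ij k by (intro nth_face[symmetric]) (auto simp: length_bar_face)
  finally show "bar_face G i (bar_face G (Suc j) xs) ! k = bar_face G j (bar_face G i xs) ! k" .
qed (use ij in \<open>simp add: length_bar_face\<close>)

lemma set_bar_face:
  assumes G: "monoid G" and xs: "set xs \<subseteq> carrier G" and i: "i \<le> length xs"
  shows "set (bar_face G i xs) \<subseteq> carrier G"
proof -
  have "bar_face G i xs ! k \<in> carrier G" if "Suc k < length xs" for k
    using that i nth_mem[of k xs] nth_mem[of "Suc k" xs] xs monoid.m_closed[OF G]
    by (auto simp: nth_bar_face subset_iff)
  then show ?thesis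
    using i by (auto simp: set_conv_nth length_bar_face)
qed

lemma bar_face_map:
  assumes f: "f \<in> hom G H" and xs: "set xs \<subseteq> carrier G" and i: "i \<le> length xs"
  shows "bar_face H i (map f xs) = map f (bar_face G i xs)"
proof (rule nth_equalityI)
  fix k assume "k < length (bar_face H i (map f xs))"
  then have k: "Suc k < length xs"
    using i by (simp add: length_bar_face)
  then have "xs ! k \<in> carrier G" "xs ! Suc k \<in> carrier G"
    using xs by (auto simp: subset_iff)
  with k i show "bar_face H i (map f xs) ! k = map f (bar_face G i xs) ! k"
    by (auto simp: nth_bar_face length_bar_face hom_mult[OF f])
qed (use i in \<open>simp add: length_bar_face\<close>)

lemma bar_boundary_0 [simp]: "bar_boundary G 0 = 0"
  by (simp add: bar_boundary_def)

lemma bar_boundary_add: "bar_boundary G (c + d) = bar_boundary G c + bar_boundary G d"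
  by (simp add: bar_boundary_def frag_extend_add)

lemma bar_boundary_diff: "bar_boundary G (c - d) = bar_boundary G c - bar_boundary G d"
  by (simp add: bar_boundary_def frag_extend_diff)

lemma bar_boundary_cmul: "bar_boundary G (frag_cmul a c) = frag_cmul a (bar_boundary G c)"
  by (simp add: bar_boundary_def frag_extend_cmul)

lemma bar_boundary_sum: "finite I \<Longrightarrow> bar_boundary G (\<Sum>i\<in>I. c i) = (\<Sum>i\<in>I. bar_boundary G (c i))"
  by (simp add: bar_boundary_def frag_extend_sum o_def)

lemma bar_boundary_frag_of:
  assumes "length xs = Suc n"
  shows "bar_boundary G (frag_of xs) =
    (\<Sum>i\<le>Suc n. frag_cmul ((-1) ^ i) (frag_of (bar_face G i xs)))"
proof -
  have "xs \<noteq> []" using assms by auto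
  then show ?thesis by (simp add: bar_boundary_def assms del: sum.atMost_Suc)
qed

lemma bar_boundary_closed:
  assumes G: "monoid G" and c: "c \<in> carrier (bar_chain_group (Suc n) G)"
  shows "bar_boundary G c \<in> carrier (bar_chain_group n G)"
proof -
  have "Poly_Mapping.keys c \<subseteq> {xs. length xs = Suc n \<and> set xs \<subseteq> carrier G}"
    using c by (simp add: bar_chain_group_def)
  then show ?thesis
  proof (induction c rule: frag_induction)
    case zero
    show ?case by (simp add: bar_chain_group_def)
  next
    case (one xs)
    then have "bar_face G i xs \<in> {xs. length xs = n \<and> set xs \<subseteq> carrier G}"
      if "i \<le> length xs" for i
      using that set_bar_face[OF G, of xs i] by (simp add: length_bar_face)
    moreover have "length xs = Suc n" using one by simp
    ultimately show ?case
      by (auto simp: bar_boundary_frag_of bar_chain_group_def subset_iff simp del: sum.atMost_Suc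
          dest!: subsetD[OF keys_sum])
  next
    case (diff c d)
    then show ?case
      by (simp add: bar_chain_group_def bar_boundary_diff subset_trans[OF keys_diff Un_least])
  qed
qed

lemma alternating_sum_of_simplicial_faces:
  fixes F :: "nat \<Rightarrow> nat \<Rightarrow> ('a \<Rightarrow>\<^sub>0 int)"
  assumes F: "\<And>i j. i \<le> j \<Longrightarrow> j \<le> n \<Longrightarrow> F i (Suc j) = F j i"
  shows "(\<Sum>j\<le>Suc n. \<Sum>i\<le>n. frag_cmul ((-1) ^ (i + j)) (F i j)) = 0"
proof -
  define t where "t = (\<lambda>(j, i). frag_cmul ((-1) ^ (i + j)) (F i j))"
  define above below
    where "above = {(j, i). i < j \<and> j \<le> Suc n}" and "below = {(j, i). j \<le> i \<and> i \<le> n}"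
  have fin: "finite above" "finite below"
    unfolding above_def below_def by (rule finite_subset[of _ "{..Suc n} \<times> {..Suc n}"]; auto)+
  have "(\<Sum>j\<le>Suc n. \<Sum>i\<le>n. frag_cmul ((-1) ^ (i + j)) (F i j)) = sum t ({..Suc n} \<times> {..n})"
    unfolding t_def by (rule sum.cartesian_product)
  also have "{..Suc n} \<times> {..n} = above \<union> below"
    by (auto simp: above_def below_def)
  also have "sum t \<dots> = sum t above + sum t below"
    by (rule sum.union_disjoint[OF fin]) (auto simp: above_def below_def)
  also have "sum t above = (\<Sum>p\<in>below. - t p)"
  proof (rule sum.reindex_bij_witness[where i = "\<lambda>(j, i). (Suc i, j)"
        and j = "\<lambda>(j, i). (i, j - 1)"])
    fix p assume "p \<in> above"
    then obtain i j where p: "p = (Suc j, i)" "i \<le> j" "j \<le> n"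
      by (cases p, cases "fst p") (auto simp: above_def)
    have "- frag_cmul a x = frag_cmul (- a) x" for a :: int and x :: "'a \<Rightarrow>\<^sub>0 int"
      by (metis frag_cmul_cmul frag_cmul_minus_one mult_minus1)
    with p show "- t (case p of (j, i) \<Rightarrow> (i, j - 1)) = t p"
      by (simp add: t_def F add.commute)
  qed (auto simp: above_def below_def)
  finally show ?thesis by (simp add: sum_negf)
qed

lemma bar_boundary_bar_boundary:
  assumes G: "monoid G" and c: "c \<in> carrier (bar_chain_group n G)"
  shows "bar_boundary G (bar_boundary G c) = 0"
proof -
  have "Poly_Mapping.keys c \<subseteq> {xs. length xs = n \<and> set xs \<subseteq> carrier G}"
    using c by (simp add: bar_chain_group_def)
  then show ?thesis
  proof (induction c rule: frag_induction)
    case (one xs)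
    show ?case
    proof (cases "length xs \<le> 1")
      case True
      then have "xs = [] \<or> (\<exists>x. xs = [x])" by (cases xs) auto
      then show ?thesis by (auto simp: bar_boundary_def bar_face_def)
    next
      case False
      then obtain m where len: "length xs = Suc (Suc m)"
        by (intro that[of "length xs - 2"]) simp
      let ?F = "\<lambda>i j. frag_of (bar_face G i (bar_face G j xs))"
      have face: "bar_boundary G (frag_of (bar_face G j xs)) =
          (\<Sum>i\<le>Suc m. frag_cmul ((-1) ^ i) (?F i j))"
        if "j \<le> Suc (Suc m)" for j
        by (rule bar_boundary_frag_of) (use that len in \<open>simp add: length_bar_face\<close>)
      have "bar_boundary G (bar_boundary G (frag_of xs)) =
          (\<Sum>j\<le>Suc (Suc m). frag_cmul ((-1) ^ j) (bar_boundary G (frag_of (bar_face G j xs))))"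
        by (simp only: bar_boundary_frag_of[OF len] bar_boundary_sum bar_boundary_cmul
            finite_atMost)
      also have "\<dots> = (\<Sum>j\<le>Suc (Suc m). \<Sum>i\<le>Suc m. frag_cmul ((-1) ^ (i + j)) (?F i j))"
        by (rule sum.cong)
          (simp_all only: face atMost_iff frag_cmul_sum frag_cmul_cmul power_add mult.commute)
      also have "\<dots> = 0"
        by (rule alternating_sum_of_simplicial_faces)
          (use one len in \<open>simp add: bar_face_bar_face[OF G]\<close>)
      finally show ?thesis .
    qed
  qed (simp_all add: bar_boundary_diff)
qed

definition bar_cycle_group :: "nat \<Rightarrow> ('a, 'm) monoid_scheme \<Rightarrow> ('a list \<Rightarrow>\<^sub>0 int) monoid"
  where "bar_cycle_group n G = (bar_chain_group n G)\<lparr>carrier := bar_cycles n G\<rparr>"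

lemma carrier_bar_cycle_group: "carrier (bar_cycle_group n G) = bar_cycles n G"
  by (simp add: bar_cycle_group_def)

lemma mult_bar_cycle_group: "c \<otimes>\<^bsub>bar_cycle_group n G\<^esub> d = c + d"
  by (simp add: bar_cycle_group_def bar_chain_group_def)

lemma bar_boundary_group_hom:
  assumes "monoid G"
  shows "group_hom (bar_chain_group (Suc n) G) (bar_chain_group n G) (bar_boundary G)"
  using bar_boundary_closed[OF assms]
  by (auto simp: group_hom_def group_hom_axioms_def hom_def bar_boundary_add
      comm_group.axioms(2)[OF comm_group_bar_chain_group])
    (auto simp: bar_chain_group_def bar_boundary_add)

lemma bar_cycles_subgroup: "subgroup (bar_cycles n G) (bar_chain_group n G)"
proof -
  have "group_hom (bar_chain_group n G) (free_Abelian_group UNIV) (bar_boundary G)"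
    by (auto simp: group_hom_def group_hom_axioms_def hom_def bar_chain_group_def bar_boundary_add)
  moreover have "bar_cycles n G =
      kernel (bar_chain_group n G) (free_Abelian_group UNIV) (bar_boundary G)"
    by (simp add: bar_cycles_def kernel_def)
  ultimately show ?thesis
    by (simp add: group_hom.subgroup_kernel)
qed

lemma comm_group_bar_cycle_group: "comm_group (bar_cycle_group n G)"
proof (rule group.group_comm_groupI)
  show "group (bar_cycle_group n G)"
    unfolding bar_cycle_group_def
    by (rule subgroup.subgroup_is_group[OF bar_cycles_subgroup])
      (rule comm_group.axioms(2)[OF comm_group_bar_chain_group])
qed (simp add: mult_bar_cycle_group add.commute)

lemma bar_cycles_add: "c \<in> bar_cycles n G \<Longrightarrow> d \<in> bar_cycles n G \<Longrightarrow> c + d \<in> bar_cycles n G"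
  using comm_groupE(1)[OF comm_group_bar_cycle_group[of n G]]
  by (simp add: carrier_bar_cycle_group mult_bar_cycle_group)

lemma bar_boundaries_subset_bar_cycles:
  assumes "monoid G"
  shows "bar_boundaries n G \<subseteq> bar_cycles n G"
  using bar_boundary_closed[OF assms] bar_boundary_bar_boundary[OF assms]
  by (auto simp: bar_boundaries_def bar_cycles_def)

lemma bar_boundaries_subgroup:
  assumes G: "monoid G"
  shows "subgroup (bar_boundaries n G) (bar_cycle_group n G)"
  unfolding bar_cycle_group_def
proof (rule group.subgroup_incl)
  show "subgroup (bar_boundaries n G) (bar_chain_group n G)"
    unfolding bar_boundaries_def
    by (rule group_hom.img_is_subgroup[OF bar_boundary_group_hom[OF G]])
  show "group (bar_chain_group n G)"
    by (rule comm_group.axioms(2)[OF comm_group_bar_chain_group])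
qed (intro bar_cycles_subgroup bar_boundaries_subset_bar_cycles[OF G])+

definition homology_class ::
    "nat \<Rightarrow> ('a, 'm) monoid_scheme \<Rightarrow> ('a list \<Rightarrow>\<^sub>0 int) \<Rightarrow> ('a list \<Rightarrow>\<^sub>0 int) set"
  where "homology_class n G c = bar_boundaries n G #>\<^bsub>bar_chain_group n G\<^esub> c"

lemma homology_class_cycle_coset:
  "homology_class n G c = bar_boundaries n G #>\<^bsub>bar_cycle_group n G\<^esub> c"
  by (simp add: homology_class_def r_coset_def bar_cycle_group_def)

lemma group_homology_eq_Mod: "group_homology n G = bar_cycle_group n G Mod bar_boundaries n G"
  by (simp add: group_homology_def bar_cycle_group_def)

lemma comm_group_group_homology:
  "monoid G \<Longrightarrow> comm_group (group_homology n G)"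
  unfolding group_homology_eq_Mod
  by (intro comm_group.abelian_FactGroup comm_group_bar_cycle_group bar_boundaries_subgroup)

lemma carrier_group_homology: "carrier (group_homology n G) = homology_class n G ` bar_cycles n G"
  by (simp add: group_homology_eq_Mod carrier_FactGroup carrier_bar_cycle_group
      homology_class_cycle_coset)

lemma homology_class_group_hom:
  assumes G: "monoid G"
  shows "group_hom (bar_cycle_group n G) (group_homology n G) (homology_class n G)"
proof -
  have "bar_boundaries n G \<lhd> bar_cycle_group n G"
    by (rule comm_group.subgroup_imp_normal[OF comm_group_bar_cycle_group
          bar_boundaries_subgroup[OF G]])
  from normal.r_coset_hom_Mod[OF this] show ?thesis
    using comm_group_bar_cycle_group[of n G] comm_group_group_homology[OF G]
    by (simp add: group_hom_def group_hom_axioms_def comm_group.axioms(2)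
        homology_class_cycle_coset[abs_def] group_homology_eq_Mod)
qed

lemma homology_class_add:
  assumes "monoid G" "c \<in> bar_cycles n G" "d \<in> bar_cycles n G"
  shows "homology_class n G (c + d) =
    homology_class n G c \<otimes>\<^bsub>group_homology n G\<^esub> homology_class n G d"
  using group_hom.hom_mult[OF homology_class_group_hom[OF assms(1)]] assms(2,3)
  by (simp add: carrier_bar_cycle_group mult_bar_cycle_group)

lemma homology_class_eqI:
  assumes G: "monoid G" and d: "d \<in> bar_cycles n G" and cd: "c - d \<in> bar_boundaries n G"
  shows "homology_class n G c = homology_class n G d"
proof -
  interpret comm_group "group_homology n G" by (rule comm_group_group_homology[OF G])
  have "homology_class n G (c - d) = \<one>\<^bsub>group_homology n G\<^esub>"
    using subgroup.rcos_const[OF bar_boundaries_subgroup[OF G]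
        comm_group.axioms(2)[OF comm_group_bar_cycle_group] cd]
    by (simp add: homology_class_cycle_coset group_homology_eq_Mod)
  moreover have "c - d \<in> bar_cycles n G"
    using bar_boundaries_subset_bar_cycles[OF G] cd by blast
  ultimately show ?thesis
    using homology_class_add[OF G, of "c - d" n d] d by (simp add: carrier_group_homology)
qed


subsection \<open>Functoriality\<close>

definition bar_chain_map :: "('a \<Rightarrow> 'b) \<Rightarrow> ('a list \<Rightarrow>\<^sub>0 int) \<Rightarrow> ('b list \<Rightarrow>\<^sub>0 int)"
  where "bar_chain_map f = frag_extend (frag_of \<circ> map f)"

lemma bar_chain_map_frag_of [simp]: "bar_chain_map f (frag_of xs) = frag_of (map f xs)"
  by (simp add: bar_chain_map_def)

lemma bar_chain_map_add: "bar_chain_map f (c + d) = bar_chain_map f c + bar_chain_map f d"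
  by (simp add: bar_chain_map_def frag_extend_add)

lemma bar_chain_map_diff: "bar_chain_map f (c - d) = bar_chain_map f c - bar_chain_map f d"
  by (simp add: bar_chain_map_def frag_extend_diff)

lemma bar_chain_map_comp: "bar_chain_map g (bar_chain_map f c) = bar_chain_map (g \<circ> f) c"
  by (simp add: bar_chain_map_def frag_extend_compose o_assoc flip: map_comp_map)

lemma bar_chain_map_cong:
  assumes "\<And>x. x \<in> carrier G \<Longrightarrow> f x = g x" and "c \<in> carrier (bar_chain_group n G)"
  shows "bar_chain_map f c = bar_chain_map g c"
  unfolding bar_chain_map_def
proof (rule frag_extend_eq)
  fix xs assume "xs \<in> Poly_Mapping.keys c"
  then have "set xs \<subseteq> carrier G"
    using assms(2) by (auto simp: bar_chain_group_def)
  then have "map f xs = map g xs"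
    using assms(1) by auto
  then show "(frag_of \<circ> map f) xs = (frag_of \<circ> map g) xs" by (simp only: o_apply)
qed

lemma bar_chain_map_closed:
  assumes f: "f \<in> hom G H" and c: "c \<in> carrier (bar_chain_group n G)"
  shows "bar_chain_map f c \<in> carrier (bar_chain_group n H)"
  using c hom_in_carrier[OF f]
  by (fastforce simp: bar_chain_map_def bar_chain_group_def dest!: subsetD[OF keys_frag_extend])

lemma bar_boundary_bar_chain_map:
  assumes f: "f \<in> hom G H" and c: "c \<in> carrier (bar_chain_group n G)"
  shows "bar_boundary H (bar_chain_map f c) = bar_chain_map f (bar_boundary G c)"
proof -
  have "Poly_Mapping.keys c \<subseteq> {xs. length xs = n \<and> set xs \<subseteq> carrier G}"
    using c by (simp add: bar_chain_group_def)
  then show ?thesis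
  proof (induction c rule: frag_induction)
    case (one xs)
    then have xs: "set xs \<subseteq> carrier G" by simp
    show ?case
    proof (cases xs)
      case Nil
      then show ?thesis by (simp add: bar_boundary_def bar_chain_map_def)
    next
      case (Cons x ys)
      then have len: "length xs = Suc (length ys)" by simp
      have "bar_boundary H (bar_chain_map f (frag_of xs)) =
          (\<Sum>i\<le>Suc (length ys). frag_cmul ((-1) ^ i) (frag_of (bar_face H i (map f xs))))"
        by (simp only: bar_chain_map_frag_of bar_boundary_frag_of length_map len)
      also have "\<dots> = (\<Sum>i\<le>Suc (length ys). frag_cmul ((-1) ^ i) (frag_of (map f (bar_face G i xs))))"
        by (rule sum.cong) (simp_all add: bar_face_map[OF f xs] len)
      also have "\<dots> = bar_chain_map f (bar_boundary G (frag_of xs))"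
        by (simp add: bar_boundary_frag_of[OF len] bar_chain_map_def frag_extend_sum o_def
            frag_extend_cmul del: sum.atMost_Suc)
      finally show ?thesis .
    qed
  next
    case (diff c d)
    then show ?case by (simp add: bar_boundary_diff bar_chain_map_diff)
  qed (simp add: bar_chain_map_def)
qed

lemma bar_chain_map_bar_cycles:
  assumes f: "f \<in> hom G H" and c: "c \<in> bar_cycles n G"
  shows "bar_chain_map f c \<in> bar_cycles n H"
  using c bar_chain_map_closed[OF f] bar_boundary_bar_chain_map[OF f]
  by (auto simp: bar_cycles_def bar_chain_map_def)

lemma bar_chain_map_bar_boundaries:
  assumes f: "f \<in> hom G H" and c: "c \<in> bar_boundaries n G"
  shows "bar_chain_map f c \<in> bar_boundaries n H"
  using c bar_chain_map_closed[OF f] bar_boundary_bar_chain_map[OF f]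
  by (force simp: bar_boundaries_def)

lemma group_homology_map_class:
  assumes GH: "monoid G" "monoid H" and f: "f \<in> hom G H" and c: "c \<in> bar_cycles n G"
  shows "group_homology_map n H f (homology_class n G c) = homology_class n H (bar_chain_map f c)"
proof -
  have "homology_class n H (bar_chain_map f (b + c)) = homology_class n H (bar_chain_map f c)"
    if "b \<in> bar_boundaries n G" for b
    by (rule homology_class_eqI[OF GH(2) bar_chain_map_bar_cycles[OF f c]])
      (simp add: bar_chain_map_add bar_chain_map_bar_boundaries[OF f that])
  moreover have "homology_class n G c = (\<lambda>b. b + c) ` bar_boundaries n G"
    by (auto simp: homology_class_def r_coset_def bar_chain_group_def)
  moreover have "bar_boundaries n G \<noteq> {}"
    using subgroup.one_closed[OF bar_boundaries_subgroup[OF GH(1)]] by blast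
  ultimately show ?thesis
    by (simp add: group_homology_map_def image_image image_constant_conv
        flip: homology_class_def bar_chain_map_def)
qed

lemma group_homology_map_hom:
  assumes GH: "monoid G" "monoid H" and f: "f \<in> hom G H"
  shows "group_homology_map n H f \<in> hom (group_homology n G) (group_homology n H)"
proof (rule homI)
  fix u assume "u \<in> carrier (group_homology n G)"
  then show "group_homology_map n H f u \<in> carrier (group_homology n H)"
    by (auto simp: carrier_group_homology group_homology_map_class[OF GH f]
        bar_chain_map_bar_cycles[OF f])
next
  fix u v assume "u \<in> carrier (group_homology n G)" "v \<in> carrier (group_homology n G)"
  then obtain c d where c: "c \<in> bar_cycles n G" "u = homology_class n G c"
    and d: "d \<in> bar_cycles n G" "v = homology_class n G d"
    by (auto simp: carrier_group_homology)
  from c d show "group_homology_map n H f (u \<otimes>\<^bsub>group_homology n G\<^esub> v) =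
      group_homology_map n H f u \<otimes>\<^bsub>group_homology n H\<^esub> group_homology_map n H f v"
    by (simp add: bar_cycles_add group_homology_map_class[OF GH f] bar_chain_map_bar_cycles[OF f]
        bar_chain_map_add homology_class_add[OF GH(2)] flip: homology_class_add[OF GH(1)])
qed

lemma group_homology_map_comp:
  assumes GHK: "monoid G" "monoid H" "monoid K" and f: "f \<in> hom G H" and g: "g \<in> hom H K"
    and u: "u \<in> carrier (group_homology n G)"
  shows "group_homology_map n K g (group_homology_map n H f u) = group_homology_map n K (g \<circ> f) u"
proof -
  obtain c where "c \<in> bar_cycles n G" "u = homology_class n G c"
    using u by (auto simp: carrier_group_homology)
  then show ?thesis
    using f g hom_compose[OF f g]
    by (simp add: group_homology_map_class GHK bar_chain_map_bar_cycles[OF f] bar_chain_map_comp)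
qed

lemma group_homology_map_cong:
  assumes GH: "monoid G" "monoid H" and fg: "f \<in> hom G H" "g \<in> hom G H"
    and eq: "\<And>x. x \<in> carrier G \<Longrightarrow> f x = g x" and u: "u \<in> carrier (group_homology n G)"
  shows "group_homology_map n H f u = group_homology_map n H g u"
proof -
  obtain c where "c \<in> bar_cycles n G" "u = homology_class n G c"
    using u by (auto simp: carrier_group_homology)
  then show ?thesis
    using bar_chain_map_cong[of G f g c n] eq
    by (simp add: group_homology_map_class GH fg) (simp add: bar_cycles_def)
qed


section \<open>The comparison map for a tower\<close>

lemma carrier_tower_lim:
  "x \<in> carrier (tower_lim A f) \<longleftrightarrow> (\<forall>i. x i \<in> carrier (A i) \<and> f i (x (Suc i)) = x i)"
  by (auto simp: tower_lim_def)

lemma mult_tower_lim: "x \<otimes>\<^bsub>tower_lim A f\<^esub> y = (\<lambda>i. x i \<otimes>\<^bsub>A i\<^esub> y i)"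
  by (simp add: tower_lim_def restrict_def)

lemma one_tower_lim: "\<one>\<^bsub>tower_lim A f\<^esub> = (\<lambda>i. \<one>\<^bsub>A i\<^esub>)"
  by (simp add: tower_lim_def restrict_def)

lemma tower_lim_proj_hom: "(\<lambda>x. x i) \<in> hom (tower_lim A f) (A i)"
  by (rule homI) (simp_all add: carrier_tower_lim mult_tower_lim)

lemma comm_group_tower_lim:
  assumes tower: "abelian_tower A f"
  shows "comm_group (tower_lim A f)"
proof (rule comm_groupI)
  note A = abelian_tower_comm_group[OF tower]
  have f: "group_hom (A (Suc i)) (A i) (f i)" for i
    using abelian_tower_hom[OF tower] A
    by (simp add: group_hom_def group_hom_axioms_def comm_group.axioms(2))
  fix x y z
  assume x: "x \<in> carrier (tower_lim A f)" and y: "y \<in> carrier (tower_lim A f)"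
    and z: "z \<in> carrier (tower_lim A f)"
  show "x \<otimes>\<^bsub>tower_lim A f\<^esub> y \<in> carrier (tower_lim A f)"
    using x y
    by (simp add: carrier_tower_lim mult_tower_lim group_hom.hom_mult[OF f] comm_groupE(1)[OF A])
  show "x \<otimes>\<^bsub>tower_lim A f\<^esub> y \<otimes>\<^bsub>tower_lim A f\<^esub> z = x \<otimes>\<^bsub>tower_lim A f\<^esub> (y \<otimes>\<^bsub>tower_lim A f\<^esub> z)"
    "x \<otimes>\<^bsub>tower_lim A f\<^esub> y = y \<otimes>\<^bsub>tower_lim A f\<^esub> x"
    "\<one>\<^bsub>tower_lim A f\<^esub> \<otimes>\<^bsub>tower_lim A f\<^esub> x = x"
    using x y z by (simp_all add: carrier_tower_lim mult_tower_lim one_tower_lim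
        comm_groupE(3-5)[OF A])
  show "\<exists>y \<in> carrier (tower_lim A f). y \<otimes>\<^bsub>tower_lim A f\<^esub> x = \<one>\<^bsub>tower_lim A f\<^esub>"
    using x by (intro bexI[of _ "\<lambda>i. inv\<^bsub>A i\<^esub> x i"])
      (simp_all add: carrier_tower_lim mult_tower_lim one_tower_lim group_hom.hom_inv[OF f]
        group.inv_closed group.l_inv comm_group.axioms(2)[OF A])
next
  show "\<one>\<^bsub>tower_lim A f\<^esub> \<in> carrier (tower_lim A f)"
    using abelian_tower_hom[OF tower] comm_group.axioms(2)[OF abelian_tower_comm_group[OF tower]]
    by (simp add: carrier_tower_lim one_tower_lim hom_one group.is_monoid)
qed

lemma abelian_tower_group_homology:
  assumes "abelian_tower A f"
  shows "abelian_tower (\<lambda>i. group_homology n (A i)) (\<lambda>i. group_homology_map n (A i) (f i))"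
  using assms abelian_tower_monoid[OF assms] abelian_tower_hom[OF assms]
  unfolding abelian_tower_def by (blast intro: comm_group_group_homology group_homology_map_hom)

lemma homology_lim_map_group_hom:
  assumes tower: "abelian_tower A f"
  shows "group_hom (group_homology n (tower_lim A f))
    (tower_lim (\<lambda>i. group_homology n (A i)) (\<lambda>i. group_homology_map n (A i) (f i)))
    (homology_lim_map n A)"
proof -
  let ?L = "tower_lim A f"
  let ?HL = "group_homology n ?L"
  let ?LH = "tower_lim (\<lambda>i. group_homology n (A i)) (\<lambda>i. group_homology_map n (A i) (f i))"
  note L = comm_group_imp_monoid[OF comm_group_tower_lim[OF tower]]
    and A = abelian_tower_monoid[OF tower] and f = abelian_tower_hom[OF tower]
  have proj: "group_homology_map n (A i) (\<lambda>x. x i) \<in> hom ?HL (group_homology n (A i))" for i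
    by (rule group_homology_map_hom[OF L A tower_lim_proj_hom])
  have "group_homology_map n (A i) (f i) (group_homology_map n (A (Suc i)) (\<lambda>x. x (Suc i)) u)
      = group_homology_map n (A i) (\<lambda>x. x i) u" if u: "u \<in> carrier ?HL" for i u
  proof -
    have "group_homology_map n (A i) (f i) (group_homology_map n (A (Suc i)) (\<lambda>x. x (Suc i)) u)
      = group_homology_map n (A i) (f i \<circ> (\<lambda>x. x (Suc i))) u"
      by (rule group_homology_map_comp[OF L A A tower_lim_proj_hom f u])
    also have "\<dots> = group_homology_map n (A i) (\<lambda>x. x i) u"
      by (rule group_homology_map_cong[OF L A hom_compose tower_lim_proj_hom _ u])
        (auto intro: tower_lim_proj_hom f simp: carrier_tower_lim)
    finally show ?thesis .
  qed
  then have "homology_lim_map n A \<in> hom ?HL ?LH"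
    using hom_in_carrier[OF proj] hom_mult[OF proj]
    by (auto simp: hom_def homology_lim_map_def carrier_tower_lim mult_tower_lim)
  then show ?thesis
    using comm_group_tower_lim[OF abelian_tower_group_homology[OF tower]]
      comm_group_group_homology[OF L]
    by (simp add: group_hom_def group_hom_axioms_def comm_group.axioms(2))
qed

definition homology_lim_kernel ::
    "nat \<Rightarrow> (nat \<Rightarrow> ('a, 'm) monoid_scheme) \<Rightarrow> (nat \<Rightarrow> 'a \<Rightarrow> 'a) \<Rightarrow> ((nat \<Rightarrow> 'a) list \<Rightarrow>\<^sub>0 int) set monoid"
  where "homology_lim_kernel n A f = (group_homology n (tower_lim A f))\<lparr>carrier :=
    kernel (group_homology n (tower_lim A f))
      (tower_lim (\<lambda>i. group_homology n (A i)) (\<lambda>i. group_homology_map n (A i) (f i)))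
      (homology_lim_map n A)\<rparr>"

lemma carrier_homology_lim_kernel:
  "u \<in> carrier (homology_lim_kernel n A f) \<longleftrightarrow> u \<in> carrier (group_homology n (tower_lim A f)) \<and>
    (\<forall>i. group_homology_map n (A i) (\<lambda>x. x i) u = \<one>\<^bsub>group_homology n (A i)\<^esub>)"
  by (simp add: homology_lim_kernel_def kernel_def homology_lim_map_def one_tower_lim fun_eq_iff)

lemma homology_lim_kernel_is_group:
  assumes "abelian_tower A f"
  shows "group (homology_lim_kernel n A f)"
  unfolding homology_lim_kernel_def
  using group_hom.subgroup_kernel[OF homology_lim_map_group_hom[OF assms]]
    group_hom.axioms(1)[OF homology_lim_map_group_hom[OF assms]]
  by (rule subgroup.subgroup_is_group)

lemma hom_restrict_homology_lim_kernel:
  "h \<in> hom (group_homology n (tower_lim A f)) C \<Longrightarrow> h \<in> hom (homology_lim_kernel n A f) C"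
  by (auto simp: hom_def homology_lim_kernel_def kernel_def)


section \<open>Pontryagin products in the second homology\<close>

text \<open>
  For commuting \<open>x\<close> and \<open>y\<close> this is the Pontryagin product of the classes of $[x]$ and $[y]$;
  otherwise $[x|y] - [y|x]$ is not a cycle.
\<close>

definition pontryagin_product :: "('a, 'm) monoid_scheme \<Rightarrow> 'a \<Rightarrow> 'a \<Rightarrow> ('a list \<Rightarrow>\<^sub>0 int) set"
  where "pontryagin_product G x y = homology_class 2 G (frag_of [x, y] - frag_of [y, x])"

lemma bar_boundary_frag_of_2:
  "bar_boundary G (frag_of [x, y]) = frag_of [y] - frag_of [x \<otimes>\<^bsub>G\<^esub> y] + frag_of [x]"
  by (simp add: bar_boundary_def bar_face_def numeral_2_eq_2)

lemma bar_boundary_frag_of_3: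
  "bar_boundary G (frag_of [x, y, z]) =
    frag_of [y, z] - frag_of [x \<otimes>\<^bsub>G\<^esub> y, z] + frag_of [x, y \<otimes>\<^bsub>G\<^esub> z] - frag_of [x, y]"
  by (simp add: bar_boundary_def bar_face_def eval_nat_numeral)

lemma commutator_in_bar_cycles:
  assumes "x \<in> carrier G" "y \<in> carrier G" "x \<otimes>\<^bsub>G\<^esub> y = y \<otimes>\<^bsub>G\<^esub> x"
  shows "frag_of [x, y] - frag_of [y, x] \<in> bar_cycles 2 G"
  using assms keys_diff[of "frag_of [x, y]" "frag_of [y, x]"]
  by (auto simp: bar_cycles_def bar_chain_group_def bar_boundary_diff bar_boundary_frag_of_2)

lemma group_homology_map_pontryagin_product:
  assumes "monoid G" "monoid H" "f \<in> hom G H" "x \<in> carrier G" "y \<in> carrier G"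
    and "x \<otimes>\<^bsub>G\<^esub> y = y \<otimes>\<^bsub>G\<^esub> x"
  shows "group_homology_map 2 H f (pontryagin_product G x y) = pontryagin_product H (f x) (f y)"
  using assms commutator_in_bar_cycles[of x G y]
  by (simp add: pontryagin_product_def group_homology_map_class bar_chain_map_diff)

context comm_group
begin

lemma pontryagin_product_closed:
  "x \<in> carrier G \<Longrightarrow> y \<in> carrier G \<Longrightarrow> pontryagin_product G x y \<in> carrier (group_homology 2 G)"
  by (simp add: pontryagin_product_def carrier_group_homology commutator_in_bar_cycles m_comm)

lemma pontryagin_product_mult_right:
  assumes xyz: "x \<in> carrier G" "y \<in> carrier G" "z \<in> carrier G"
  shows "pontryagin_product G x (y \<otimes> z) =
    pontryagin_product G x y \<otimes>\<^bsub>group_homology 2 G\<^esub> pontryagin_product G x z"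
proof -
  let ?c = "\<lambda>x y. frag_of [x, y] - frag_of [y, x]"
  \<comment> \<open>the shuffle product of $[x]$ and $[y|z]$\<close>
  let ?d = "frag_of [x, y, z] - frag_of [y, x, z] + frag_of [y, z, x]"
  have cycles: "?c x y \<in> bar_cycles 2 G" "?c x z \<in> bar_cycles 2 G"
    using xyz by (simp_all add: commutator_in_bar_cycles m_comm)
  have "?c x (y \<otimes> z) - (?c x y + ?c x z) = bar_boundary G ?d"
    using m_comm[of x y] m_comm[of x z] xyz
    by (simp add: bar_boundary_add bar_boundary_diff bar_boundary_frag_of_3)
  moreover have "?d \<in> carrier (bar_chain_group (Suc 2) G)"
    using xyz by (auto simp: bar_chain_group_def dest!: subsetD[OF keys_add] subsetD[OF keys_diff])
  ultimately have "?c x (y \<otimes> z) - (?c x y + ?c x z) \<in> bar_boundaries 2 G"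
    by (simp add: bar_boundaries_def)
  then show ?thesis
    unfolding pontryagin_product_def homology_class_add[OF is_monoid cycles, symmetric]
    by (rule homology_class_eqI[OF is_monoid bar_cycles_add[OF cycles]])
qed

lemma pontryagin_product_swap:
  assumes "x \<in> carrier G" "y \<in> carrier G"
  shows "pontryagin_product G y x = inv\<^bsub>group_homology 2 G\<^esub> pontryagin_product G x y"
proof -
  let ?c = "frag_of [x, y] - frag_of [y, x]"
  have c: "?c \<in> bar_cycles 2 G"
    using assms by (simp add: commutator_in_bar_cycles m_comm)
  interpret Z: comm_group "bar_cycle_group 2 G" by (rule comm_group_bar_cycle_group)
  interpret group_hom "bar_cycle_group 2 G" "group_homology 2 G" "homology_class 2 G"
    by (rule homology_class_group_hom) (rule is_monoid)
  have "inv\<^bsub>bar_cycle_group 2 G\<^esub> ?c = frag_of [y, x] - frag_of [x, y]"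
  proof (rule Z.inv_equality)
    show "(frag_of [y, x] - frag_of [x, y]) \<otimes>\<^bsub>bar_cycle_group 2 G\<^esub> ?c = \<one>\<^bsub>bar_cycle_group 2 G\<^esub>"
      by (simp add: mult_bar_cycle_group) (simp add: bar_cycle_group_def bar_chain_group_def)
  qed (use assms c in \<open>simp_all add: carrier_bar_cycle_group commutator_in_bar_cycles m_comm\<close>)
  then show ?thesis
    using c hom_inv[of ?c] by (simp add: pontryagin_product_def carrier_bar_cycle_group)
qed

lemma pontryagin_product_group_hom:
  assumes "x \<in> carrier G"
  shows "group_hom G (group_homology 2 G) (pontryagin_product G x)"
  using assms comm_group.axioms(2)[OF comm_group_group_homology[OF is_monoid]]
  by (auto simp: group_hom_def group_hom_axioms_def hom_def pontryagin_product_closed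
      pontryagin_product_mult_right)

lemma pontryagin_product_annihilated:
  fixes m :: nat
  assumes xy: "x \<in> carrier G" "y \<in> carrier G" and "x [^] m = \<one>"
  shows "pontryagin_product G x (y [^] m) = \<one>\<^bsub>group_homology 2 G\<^esub>"
proof -
  interpret x: group_hom G "group_homology 2 G" "pontryagin_product G x"
    by (rule pontryagin_product_group_hom[OF xy(1)])
  interpret y: group_hom G "group_homology 2 G" "pontryagin_product G y"
    by (rule pontryagin_product_group_hom[OF xy(2)])
  have "pontryagin_product G x (y [^] m) =
      (inv\<^bsub>group_homology 2 G\<^esub> pontryagin_product G y x) [^]\<^bsub>group_homology 2 G\<^esub> m"
    using xy by (simp add: x.hom_nat_pow flip: pontryagin_product_swap)
  also have "\<dots> = inv\<^bsub>group_homology 2 G\<^esub> (pontryagin_product G y x [^]\<^bsub>group_homology 2 G\<^esub> m)"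
    using xy by (simp add: x.H.nat_pow_inv)
  also have "pontryagin_product G y x [^]\<^bsub>group_homology 2 G\<^esub> m = \<one>\<^bsub>group_homology 2 G\<^esub>"
    using assms by (simp flip: y.hom_nat_pow)
  finally show ?thesis by simp
qed

end

lemma hom_free_Abelian_group_trivial:
  assumes h: "group_hom (free_Abelian_group S) C h" and c: "c \<in> carrier (free_Abelian_group S)"
    and S: "\<And>s. s \<in> S \<Longrightarrow> h (frag_of s) = \<one>\<^bsub>C\<^esub>"
  shows "h c = \<one>\<^bsub>C\<^esub>"
proof -
  interpret group_hom "free_Abelian_group S" C h by (rule h)
  show ?thesis
  proof (rule free_Abelian_group_induct[of c S])
    show "Poly_Mapping.keys c \<subseteq> S" using c by simp
    show "h 0 = \<one>\<^bsub>C\<^esub>" using hom_one by simp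
  next
    fix x y
    assume "Poly_Mapping.keys x \<subseteq> S" "Poly_Mapping.keys y \<subseteq> S" "h x = \<one>\<^bsub>C\<^esub>" "h y = \<one>\<^bsub>C\<^esub>"
    then show "h (x - y) = \<one>\<^bsub>C\<^esub>"
      using hom_mult[of x "inv\<^bsub>free_Abelian_group S\<^esub> y"] hom_inv[of y] by simp
  qed (rule S)
qed

lemma bar_chain_add_closed:
  assumes "c \<in> carrier (bar_chain_group n G)" "d \<in> carrier (bar_chain_group n G)"
  shows "c + d \<in> carrier (bar_chain_group n G)"
  using comm_groupE(1)[OF comm_group_bar_chain_group assms] by (simp add: bar_chain_group_def)

lemma bar_chain_hom_add:
  assumes "group_hom (bar_chain_group n G) C \<phi>"
    and "c \<in> carrier (bar_chain_group n G)" "d \<in> carrier (bar_chain_group n G)"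
  shows "\<phi> (c + d) = \<phi> c \<otimes>\<^bsub>C\<^esub> \<phi> d"
  using group_hom.hom_mult[OF assms] by (simp add: bar_chain_group_def)

lemma bar_chain_hom_diff:
  assumes "group_hom (bar_chain_group n G) C \<phi>"
    and "c \<in> carrier (bar_chain_group n G)" "d \<in> carrier (bar_chain_group n G)"
  shows "\<phi> (c - d) = \<phi> c \<otimes>\<^bsub>C\<^esub> inv\<^bsub>C\<^esub> \<phi> d"
proof -
  interpret group_hom "bar_chain_group n G" C \<phi> by (rule assms(1))
  show ?thesis
    using assms(2,3) hom_mult[of c "inv\<^bsub>bar_chain_group n G\<^esub> d"] hom_inv[of d]
    by (simp add: bar_chain_group_def)
qed

lemma two_cocycle_vanishes_on_bar_boundaries:
  assumes G: "monoid G" and C: "comm_group C" and \<phi>: "group_hom (bar_chain_group 2 G) C \<phi>"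
    and cocycle: "\<And>x y z. x \<in> carrier G \<Longrightarrow> y \<in> carrier G \<Longrightarrow> z \<in> carrier G \<Longrightarrow>
      \<phi> (frag_of [y, z]) \<otimes>\<^bsub>C\<^esub> \<phi> (frag_of [x, y \<otimes>\<^bsub>G\<^esub> z]) =
      \<phi> (frag_of [x \<otimes>\<^bsub>G\<^esub> y, z]) \<otimes>\<^bsub>C\<^esub> \<phi> (frag_of [x, y])"
    and c: "c \<in> bar_boundaries 2 G"
  shows "\<phi> c = \<one>\<^bsub>C\<^esub>"
proof -
  interpret C: comm_group C by (rule C)
  interpret \<phi>: group_hom "bar_chain_group 2 G" C \<phi> by (rule \<phi>)
  interpret boundary: group_hom "bar_chain_group (Suc 2) G" "bar_chain_group 2 G" "bar_boundary G"
    by (rule bar_boundary_group_hom[OF G])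
  obtain d where d: "d \<in> carrier (bar_chain_group (Suc 2) G)" "c = bar_boundary G d"
    using c by (auto simp: bar_boundaries_def)
  have "group_hom (bar_chain_group (Suc 2) G) C (\<phi> \<circ> bar_boundary G)"
    by unfold_locales (rule Group.hom_compose[OF boundary.homh \<phi>.homh])
  then have "(\<phi> \<circ> bar_boundary G) d = \<one>\<^bsub>C\<^esub>"
    using d(1) unfolding bar_chain_group_def
  proof (rule hom_free_Abelian_group_trivial)
    fix xs assume xs: "xs \<in> {xs. length xs = Suc 2 \<and> set xs \<subseteq> carrier G}"
    then obtain x y z where "xs = [x, y, z]"
      by (auto simp: eval_nat_numeral length_Suc_conv)
    with xs have xyz: "xs = [x, y, z]" "x \<in> carrier G" "y \<in> carrier G" "z \<in> carrier G"
      by auto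
    then have "x \<otimes>\<^bsub>G\<^esub> y \<in> carrier G" "y \<otimes>\<^bsub>G\<^esub> z \<in> carrier G"
      using monoid.m_closed[OF G] by auto
    with xyz have pairs: "frag_of [y, z] \<in> carrier (bar_chain_group 2 G)"
      "frag_of [x, y \<otimes>\<^bsub>G\<^esub> z] \<in> carrier (bar_chain_group 2 G)"
      "frag_of [x \<otimes>\<^bsub>G\<^esub> y, z] \<in> carrier (bar_chain_group 2 G)"
      "frag_of [x, y] \<in> carrier (bar_chain_group 2 G)"
      by (simp_all add: bar_chain_group_def)
    have "bar_boundary G (frag_of xs) =
        (frag_of [y, z] + frag_of [x, y \<otimes>\<^bsub>G\<^esub> z]) - (frag_of [x \<otimes>\<^bsub>G\<^esub> y, z] + frag_of [x, y])"
      by (simp add: xyz(1) bar_boundary_frag_of_3)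
    also have "\<phi> \<dots> = (\<phi> (frag_of [y, z]) \<otimes>\<^bsub>C\<^esub> \<phi> (frag_of [x, y \<otimes>\<^bsub>G\<^esub> z])) \<otimes>\<^bsub>C\<^esub>
        inv\<^bsub>C\<^esub> (\<phi> (frag_of [x \<otimes>\<^bsub>G\<^esub> y, z]) \<otimes>\<^bsub>C\<^esub> \<phi> (frag_of [x, y]))"
      using pairs
      by (simp add: bar_chain_hom_diff[OF \<phi>] bar_chain_hom_add[OF \<phi>] bar_chain_add_closed)
    also have "\<dots> = \<one>\<^bsub>C\<^esub>"
      using xyz pairs by (simp add: cocycle)
    finally show "(\<phi> \<circ> bar_boundary G) (frag_of xs) = \<one>\<^bsub>C\<^esub>" by simp
  qed
  with d(2) show ?thesis by simp
qed

lemma group_homology_universal: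
  assumes G: "monoid G" and C: "group C" and \<phi>: "\<phi> \<in> hom (bar_cycle_group n G) C"
    and boundaries: "\<And>c. c \<in> bar_boundaries n G \<Longrightarrow> \<phi> c = \<one>\<^bsub>C\<^esub>"
  obtains h where "h \<in> hom (group_homology n G) C"
    and "\<And>c. c \<in> bar_cycles n G \<Longrightarrow> h (homology_class n G c) = \<phi> c"
proof -
  interpret Z: comm_group "bar_cycle_group n G" by (rule comm_group_bar_cycle_group)
  interpret group_hom "bar_cycle_group n G" C \<phi>
    using \<phi> C Z.group_axioms by (simp add: group_hom_def group_hom_axioms_def)
  have "bar_boundaries n G \<subseteq> kernel (bar_cycle_group n G) C \<phi>"
    using bar_boundaries_subset_bar_cycles[OF G, of n] boundaries
    by (auto simp: kernel_def carrier_bar_cycle_group)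
  from FactGroup_universal_kernel[OF Z.subgroup_imp_normal[OF bar_boundaries_subgroup[OF G]] this]
  obtain h where "h \<in> hom (group_homology n G) C"
    "\<And>c. c \<in> bar_cycles n G \<Longrightarrow> h (homology_class n G c) = \<phi> c"
    by (auto simp: group_homology_eq_Mod homology_class_cycle_coset carrier_bar_cycle_group)
  then show thesis by (rule that)
qed

lemma two_cocycle_induces_hom:
  assumes G: "monoid G" and C: "comm_group C"
    and \<beta>: "\<And>x y. x \<in> carrier G \<Longrightarrow> y \<in> carrier G \<Longrightarrow> \<beta> x y \<in> carrier C"
    and cocycle: "\<And>x y z. x \<in> carrier G \<Longrightarrow> y \<in> carrier G \<Longrightarrow> z \<in> carrier G \<Longrightarrow>
      \<beta> y z \<otimes>\<^bsub>C\<^esub> \<beta> x (y \<otimes>\<^bsub>G\<^esub> z) = \<beta> (x \<otimes>\<^bsub>G\<^esub> y) z \<otimes>\<^bsub>C\<^esub> \<beta> x y"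
  obtains h where "h \<in> hom (group_homology 2 G) C"
    and "\<And>x y. x \<in> carrier G \<Longrightarrow> y \<in> carrier G \<Longrightarrow> x \<otimes>\<^bsub>G\<^esub> y = y \<otimes>\<^bsub>G\<^esub> x \<Longrightarrow>
      h (pontryagin_product G x y) = \<beta> x y \<otimes>\<^bsub>C\<^esub> inv\<^bsub>C\<^esub> \<beta> y x"
proof -
  interpret C: comm_group C by (rule C)
  let ?pairs = "{xs. length xs = 2 \<and> set xs \<subseteq> carrier G}"
  have "(\<lambda>xs. \<beta> (xs ! 0) (xs ! 1)) ` ?pairs \<subseteq> carrier C"
    by (auto simp: subset_iff intro!: \<beta>)
  then obtain \<phi> where \<phi>: "\<phi> \<in> hom (bar_chain_group 2 G) C"
    and "\<And>xs. xs \<in> ?pairs \<Longrightarrow> \<phi> (frag_of xs) = \<beta> (xs ! 0) (xs ! 1)"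
    unfolding bar_chain_group_def by (rule C.free_Abelian_group_universal) blast
  then have \<phi>_pair: "\<phi> (frag_of [x, y]) = \<beta> x y" if "x \<in> carrier G" "y \<in> carrier G" for x y
    using that by simp
  have \<phi>_hom: "group_hom (bar_chain_group 2 G) C \<phi>"
    using \<phi> C.group_axioms comm_group.axioms(2)[OF comm_group_bar_chain_group]
    by (simp add: group_hom_def group_hom_axioms_def)
  have "\<phi> c = \<one>\<^bsub>C\<^esub>" if "c \<in> bar_boundaries 2 G" for c
    using \<phi>_hom _ that
    by (rule two_cocycle_vanishes_on_bar_boundaries[OF G C])
      (simp add: \<phi>_pair cocycle monoid.m_closed[OF G])
  moreover have "\<phi> \<in> hom (bar_cycle_group 2 G) C"
    using \<phi> by (auto simp: hom_def bar_cycle_group_def bar_cycles_def)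
  ultimately obtain h where h: "h \<in> hom (group_homology 2 G) C"
    and h_class: "\<And>c. c \<in> bar_cycles 2 G \<Longrightarrow> h (homology_class 2 G c) = \<phi> c"
    using group_homology_universal[OF G C.group_axioms] by blast
  show thesis
  proof (rule that[OF h])
    fix x y assume xy: "x \<in> carrier G" "y \<in> carrier G" "x \<otimes>\<^bsub>G\<^esub> y = y \<otimes>\<^bsub>G\<^esub> x"
    then have "frag_of [x, y] \<in> carrier (bar_chain_group 2 G)"
      "frag_of [y, x] \<in> carrier (bar_chain_group 2 G)"
      by (simp_all add: bar_chain_group_def)
    with xy show "h (pontryagin_product G x y) = \<beta> x y \<otimes>\<^bsub>C\<^esub> inv\<^bsub>C\<^esub> \<beta> y x"
      by (simp add: pontryagin_product_def h_class commutator_in_bar_cycles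
          bar_chain_hom_diff[OF \<phi>_hom] \<phi>_pair)
  qed
qed

corollary bilinear_map_induces_hom:
  assumes G: "monoid G" and C: "comm_group C"
    and left: "\<And>y. y \<in> carrier G \<Longrightarrow> (\<lambda>x. \<beta> x y) \<in> hom G C"
    and right: "\<And>x. x \<in> carrier G \<Longrightarrow> \<beta> x \<in> hom G C"
  obtains h where "h \<in> hom (group_homology 2 G) C"
    and "\<And>x y. x \<in> carrier G \<Longrightarrow> y \<in> carrier G \<Longrightarrow> x \<otimes>\<^bsub>G\<^esub> y = y \<otimes>\<^bsub>G\<^esub> x \<Longrightarrow>
      h (pontryagin_product G x y) = \<beta> x y \<otimes>\<^bsub>C\<^esub> inv\<^bsub>C\<^esub> \<beta> y x"
proof (rule two_cocycle_induces_hom[OF G C, of \<beta>])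
  interpret comm_group C by (rule C)
  show "\<beta> x y \<in> carrier C" if "x \<in> carrier G" "y \<in> carrier G" for x y
    using hom_in_carrier[OF right] that by blast
  then show "\<beta> y z \<otimes>\<^bsub>C\<^esub> \<beta> x (y \<otimes>\<^bsub>G\<^esub> z) = \<beta> (x \<otimes>\<^bsub>G\<^esub> y) z \<otimes>\<^bsub>C\<^esub> \<beta> x y"
    if "x \<in> carrier G" "y \<in> carrier G" "z \<in> carrier G" for x y z
    using that hom_mult[OF left[of z], of x y] hom_mult[OF right[of x], of y z] by (simp add: m_ac)
qed (rule that)


section \<open>A criterion\<close>

theorem homology_lim_kernel_not_cotorsion:
  fixes A :: "nat \<Rightarrow> ('a, 'm) monoid_scheme" and f :: "nat \<Rightarrow> 'a \<Rightarrow> 'a"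
  defines "L \<equiv> tower_lim A f"
  assumes tower: "abelian_tower A f" and C: "comm_group C"
    and left: "\<And>y. y \<in> carrier L \<Longrightarrow> (\<lambda>x. \<beta> x y) \<in> hom L C"
    and right: "\<And>x. x \<in> carrier L \<Longrightarrow> \<beta> x \<in> hom L C"
    and b: "b \<in> carrier L" and c: "\<And>n. c n \<in> carrier L"
    and annihilated: "\<And>n i. \<exists>q :: nat. b i [^]\<^bsub>A i\<^esub> q = \<one>\<^bsub>A i\<^esub> \<and>
      (\<exists>y \<in> carrier (A i). c n i = y [^]\<^bsub>A i\<^esub> q)"
    and unsolvable: "\<not> recurrence_solvable C m (\<lambda>n. \<beta> b (c n) \<otimes>\<^bsub>C\<^esub> inv\<^bsub>C\<^esub> \<beta> (c n) b)"
  shows "\<not> cotorsion_group (homology_lim_kernel 2 A f)"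
proof
  let ?K = "homology_lim_kernel 2 A f"
  let ?k = "\<lambda>n. pontryagin_product L b (c n)"
  assume cotorsion: "cotorsion_group ?K"
  interpret L: comm_group L
    unfolding L_def by (rule comm_group_tower_lim[OF tower])
  have b_in: "b i \<in> carrier (A i)" for i
    using b by (simp add: L_def carrier_tower_lim)
  have "group_homology_map 2 (A i) (\<lambda>x. x i) (?k n) = \<one>\<^bsub>group_homology 2 (A i)\<^esub>" for n i
  proof -
    obtain q :: nat and y where "b i [^]\<^bsub>A i\<^esub> q = \<one>\<^bsub>A i\<^esub>" "y \<in> carrier (A i)" "c n i = y [^]\<^bsub>A i\<^esub> q"
      using annihilated by blast
    then have "pontryagin_product (A i) (b i) (c n i) = \<one>\<^bsub>group_homology 2 (A i)\<^esub>"
      using comm_group.pontryagin_product_annihilated[OF abelian_tower_comm_group[OF tower] b_in]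
      by simp
    then show ?thesis
      using group_homology_map_pontryagin_product[OF L.is_monoid abelian_tower_monoid[OF tower]
          tower_lim_proj_hom[of i A f, folded L_def] b c] L.m_comm[OF b c] by simp
  qed
  then have k: "?k n \<in> carrier ?K" for n
    using L.pontryagin_product_closed[OF b c] by (simp add: carrier_homology_lim_kernel L_def)
  obtain h where h: "h \<in> hom (group_homology 2 L) C"
    and h_pontryagin: "\<And>x y. x \<in> carrier L \<Longrightarrow> y \<in> carrier L \<Longrightarrow> x \<otimes>\<^bsub>L\<^esub> y = y \<otimes>\<^bsub>L\<^esub> x \<Longrightarrow>
      h (pontryagin_product L x y) = \<beta> x y \<otimes>\<^bsub>C\<^esub> inv\<^bsub>C\<^esub> \<beta> y x"
    by (rule bilinear_map_induces_hom[OF L.is_monoid C left right]) blast+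
  have K: "group ?K"
    by (rule homology_lim_kernel_is_group[OF tower])
  have "group_hom ?K C h"
    using K comm_group.axioms(2)[OF C] hom_restrict_homology_lim_kernel[OF h[unfolded L_def]]
    by (simp add: group_hom_def group_hom_axioms_def)
  then have "recurrence_solvable C m (\<lambda>n. h (?k n))"
    by (rule recurrence_solvable_hom[OF _ k recurrence_solvable_cotorsion_group[OF K cotorsion k]])
  moreover have "h (?k n) = \<beta> b (c n) \<otimes>\<^bsub>C\<^esub> inv\<^bsub>C\<^esub> \<beta> (c n) b" for n
    by (rule h_pontryagin[OF b c L.m_comm[OF b c]])
  ultimately show False
    using unsolvable by (simp only:)
qed


section \<open>Powers with \<open>p\<close>-adic exponents\<close>

definition adic_integer_group :: "nat \<Rightarrow> (nat \<Rightarrow> int) monoid"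
  where "adic_integer_group p = tower_lim (\<lambda>i. integer_mod_group (p ^ i)) (\<lambda>i a. a mod int (p ^ i))"

definition p_primary :: "nat \<Rightarrow> ('a, 'm) monoid_scheme \<Rightarrow> bool"
  where "p_primary p G \<longleftrightarrow> (\<forall>c \<in> carrier G. \<exists>i. c [^]\<^bsub>G\<^esub> (p ^ i) = \<one>\<^bsub>G\<^esub>)"

text \<open>Meaningful only if some power $p^i$ annihilates \<open>c\<close>.\<close>

definition adic_pow :: "('a, 'm) monoid_scheme \<Rightarrow> nat \<Rightarrow> 'a \<Rightarrow> (nat \<Rightarrow> int) \<Rightarrow> 'a"
  where "adic_pow G p c a = c [^]\<^bsub>G\<^esub> a (LEAST i. c [^]\<^bsub>G\<^esub> (p ^ i) = \<one>\<^bsub>G\<^esub>)"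

lemma mult_adic_integer_group:
  "a \<otimes>\<^bsub>adic_integer_group p\<^esub> b = (\<lambda>i. (a i + b i) mod int (p ^ i))"
  by (simp add: adic_integer_group_def mult_tower_lim)

lemma mod_hom_integer_mod_group:
  assumes "m dvd n" "m > 0"
  shows "(\<lambda>a. a mod int m) \<in> hom (integer_mod_group n) (integer_mod_group m)"
  using assms by (auto simp: hom_def carrier_integer_mod_group mod_mod_cancel mod_simps)

lemma comm_group_adic_integer_group:
  assumes "p > 0"
  shows "comm_group (adic_integer_group p)"
  unfolding adic_integer_group_def
  using mod_hom_integer_mod_group[of "p ^ i" "p ^ Suc i" for i] assms
  by (intro comm_group_tower_lim) (simp add: abelian_tower_def)

lemma adic_integer_cong:
  assumes a: "a \<in> carrier (adic_integer_group p)" and ij: "i \<le> j"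
  shows "int (p ^ i) dvd a j - a i"
  using ij
proof (induction j rule: dec_induct)
  case (step j)
  have "a j = a (Suc j) mod int (p ^ j)"
    using a by (simp add: adic_integer_group_def carrier_tower_lim)
  then have "int (p ^ j) dvd a (Suc j) - a j" by simp
  then have "int (p ^ i) dvd a (Suc j) - a j"
    using step.hyps by (meson dvd_trans le_imp_power_dvd of_nat_dvd_iff)
  with step.IH have "int (p ^ i) dvd (a (Suc j) - a j) + (a j - a i)" by (rule dvd_add[rotated])
  then show ?case by simp
qed simp

context group
begin

lemma int_pow_cong:
  fixes q :: nat
  assumes "c \<in> carrier G" "c [^] q = \<one>" "int q dvd a - b"
  shows "c [^] a = c [^] b"
proof -
  have "int (ord c) dvd a - b"
    using assms pow_eq_id[of c q] by (meson dvd_trans of_nat_dvd_iff)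
  then show ?thesis
    using assms(1) by (simp add: int_pow_eq dvd_diff_commute)
qed

lemma adic_pow_1:
  assumes c: "c \<in> carrier G" and ci: "c [^] (p ^ i) = \<one>"
  shows "adic_pow G p c (\<lambda>i. 1 mod int (p ^ i)) = c"
proof -
  let ?l = "LEAST i. c [^] (p ^ i) = \<one>"
  have "c [^] (p ^ ?l) = \<one>"
    by (rule LeastI[of "\<lambda>i. c [^] (p ^ i) = \<one>", OF ci])
  then have "c [^] (1 mod int (p ^ ?l)) = c [^] (1 :: int)"
    by (rule int_pow_cong[OF c]) (simp flip: mod_eq_dvd_iff)
  then show ?thesis using c by (simp add: adic_pow_def)
qed

lemma adic_pow_eq:
  assumes c: "c \<in> carrier G" and a: "a \<in> carrier (adic_integer_group p)" and ci: "c [^] (p ^ i) = \<one>"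
  shows "adic_pow G p c a = c [^] a i"
proof -
  let ?l = "LEAST i. c [^] (p ^ i) = \<one>"
  have l: "c [^] (p ^ ?l) = \<one>" "?l \<le> i"
    using LeastI[of "\<lambda>i. c [^] (p ^ i) = \<one>", OF ci]
      Least_le[of "\<lambda>i. c [^] (p ^ i) = \<one>", OF ci] by blast+
  have "c [^] a i = c [^] a ?l"
    by (rule int_pow_cong[OF c l(1) adic_integer_cong[OF a l(2)]])
  then show ?thesis by (simp add: adic_pow_def)
qed

lemma adic_pow_hom_exponent:
  assumes p: "p > 0" and c: "c \<in> carrier G" and ci: "c [^] (p ^ i) = \<one>"
  shows "adic_pow G p c \<in> hom (adic_integer_group p) G"
proof (rule homI)
  fix a b assume a: "a \<in> carrier (adic_integer_group p)" and b: "b \<in> carrier (adic_integer_group p)"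
  show "adic_pow G p c a \<in> carrier G" for a
    using c by (simp add: adic_pow_def)
  have "adic_pow G p c (a \<otimes>\<^bsub>adic_integer_group p\<^esub> b) = c [^] ((a i + b i) mod int (p ^ i))"
    using adic_pow_eq[OF c comm_groupE(1)[OF comm_group_adic_integer_group[OF p] a b] ci]
    by (simp add: mult_adic_integer_group)
  also have "\<dots> = c [^] (a i + b i)"
    by (rule int_pow_cong[OF c ci]) (simp flip: mod_eq_dvd_iff)
  also have "\<dots> = adic_pow G p c a \<otimes> adic_pow G p c b"
    by (simp add: int_pow_mult c adic_pow_eq[OF c _ ci] a b)
  finally show "adic_pow G p c (a \<otimes>\<^bsub>adic_integer_group p\<^esub> b) = adic_pow G p c a \<otimes> adic_pow G p c b" .
qed

end

lemma (in comm_group) adic_pow_hom_base: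
  assumes primary: "p_primary p G" and a: "a \<in> carrier (adic_integer_group p)"
  shows "(\<lambda>c. adic_pow G p c a) \<in> hom G G"
proof (rule homI)
  fix c d assume c: "c \<in> carrier G" and d: "d \<in> carrier G"
  show "adic_pow G p c a \<in> carrier G"
    using c by (simp add: adic_pow_def)
  obtain i j where "c [^] (p ^ i) = \<one>" "d [^] (p ^ j) = \<one>"
    using primary c d unfolding p_primary_def by blast
  then have ij: "c [^] (p ^ (i + j)) = \<one>" "d [^] (p ^ (i + j)) = \<one>"
    using c d by (auto simp: pow_eq_id power_add)
  then have "(c \<otimes> d) [^] (p ^ (i + j)) = \<one>"
    using c d by (simp add: nat_pow_distrib)
  then show "adic_pow G p (c \<otimes> d) a = adic_pow G p c a \<otimes> adic_pow G p d a"
    using c d ij by (simp add: adic_pow_eq[OF _ a, of _ "i + j"] int_pow_distrib)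
qed


section \<open>Products of a finite cyclic tower with a constant group\<close>

lemma comm_group_DirProd:
  assumes G: "comm_group G" and H: "comm_group H"
  shows "comm_group (G \<times>\<times> H)"
  by (rule group.group_comm_groupI)
    (auto simp: DirProd_group comm_group.axioms(2)[OF G] comm_group.axioms(2)[OF H]
      comm_groupE(4)[OF G] comm_groupE(4)[OF H])

lemma nat_pow_DirProd: "(a, c) [^]\<^bsub>G \<times>\<times> H\<^esub> (n :: nat) = (a [^]\<^bsub>G\<^esub> n, c [^]\<^bsub>H\<^esub> n)"
  by (induction n) (simp_all add: nat_pow_def)

lemma (in comm_group) inj_imp_image_group_is_comm_group:
  assumes "inj_on f (carrier G)"
  shows "comm_group (image_group f G)"
  using iso_imp_img_comm_group[OF inj_imp_image_group_iso[OF assms]] by (simp add: image_group_def)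

text \<open>\<open>code\<close> only serves to place the groups $\mathbb{Z}/p^i \times C$ in a prescribed type.\<close>

locale cyclic_product_tower =
  fixes code :: "int \<times> 'c \<Rightarrow> 'a" and p :: nat and C :: "'c monoid"
  assumes inj_code: "inj code" and p_pos: "p > 0" and C: "comm_group C" and primary: "p_primary p C"
begin

abbreviation cyclic_product :: "nat \<Rightarrow> (int \<times> 'c) monoid"
  where "cyclic_product i \<equiv> integer_mod_group (p ^ i) \<times>\<times> C"

abbreviation decode :: "'a \<Rightarrow> int \<times> 'c"
  where "decode \<equiv> inv_into UNIV code"

definition level :: "nat \<Rightarrow> 'a monoid"
  where "level i = image_group code (cyclic_product i)"

definition transition :: "nat \<Rightarrow> 'a \<Rightarrow> 'a"
  where "transition i = code \<circ> (\<lambda>(a, c). (a mod int (p ^ i), c)) \<circ> decode"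

abbreviation limit :: "(nat \<Rightarrow> 'a) monoid"
  where "limit \<equiv> tower_lim level transition"

definition adic_part :: "(nat \<Rightarrow> 'a) \<Rightarrow> nat \<Rightarrow> int"
  where "adic_part x = (\<lambda>i. fst (decode (x i)))"

definition constant_part :: "(nat \<Rightarrow> 'a) \<Rightarrow> 'c"
  where "constant_part x = snd (decode (x 0))"

lemma decode_code [simp]: "decode (code u) = u"
  by (rule inv_f_f[OF inj_code])

lemma code_hom: "code \<in> hom (cyclic_product i) (level i)"
  unfolding level_def
  by (rule iso_imp_homomorphism[OF inj_imp_image_group_iso[OF
          inj_on_subset[OF inj_code subset_UNIV]]])

lemma decode_hom: "decode \<in> hom (level i) (cyclic_product i)"
  unfolding level_def
  by (rule iso_imp_homomorphism[OF inj_imp_image_group_inv_iso[OF inj_code]])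

lemma comm_group_cyclic_product: "comm_group (cyclic_product i)"
  by (rule comm_group_DirProd[OF abelian_integer_mod_group C])

lemma comm_group_level: "comm_group (level i)"
  unfolding level_def
  by (rule comm_group.inj_imp_image_group_is_comm_group[OF comm_group_cyclic_product
        inj_on_subset[OF inj_code subset_UNIV]])

lemma code_in_level: "code (a, c) \<in> carrier (level i) \<longleftrightarrow> 0 \<le> a \<and> a < int (p ^ i) \<and> c \<in> carrier C"
  using inj_code p_pos
  by (auto simp: level_def image_group_carrier carrier_integer_mod_group inj_image_mem_iff)

lemma one_level: "\<one>\<^bsub>level i\<^esub> = code (0, \<one>\<^bsub>C\<^esub>)"
  by (simp add: level_def image_group_one)

lemma code_pow:
  assumes "code (a, c) \<in> carrier (level i)"
  shows "code (a, c) [^]\<^bsub>level i\<^esub> (n :: nat) = code (int n * a mod int (p ^ i), c [^]\<^bsub>C\<^esub> n)"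
proof -
  have "(a, c) \<in> carrier (cyclic_product i)"
    using assms p_pos by (simp add: code_in_level carrier_integer_mod_group)
  then have "code ((a, c) [^]\<^bsub>cyclic_product i\<^esub> n) = code (a, c) [^]\<^bsub>level i\<^esub> n"
    by (rule hom_nat_pow[OF code_hom])
      (simp_all add: comm_group.axioms(2) comm_group_cyclic_product comm_group_level)
  then show ?thesis by (simp add: nat_pow_DirProd)
qed

lemma transition_code: "transition i (code (a, c)) = code (a mod int (p ^ i), c)"
  by (simp add: transition_def)

lemma transition_hom: "transition i \<in> hom (level (Suc i)) (level i)"
proof -
  have "(\<lambda>(a, c). (a mod int (p ^ i), c)) \<in> hom (cyclic_product (Suc i)) (cyclic_product i)"
    using C p_pos mod_hom_integer_mod_group[of "p ^ i" "p ^ Suc i"]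
    by (subst hom_paired2) (simp_all add: comm_group.axioms(2) hom_def)
  then show ?thesis
    unfolding transition_def
    by (intro Group.hom_compose[OF decode_hom] Group.hom_compose[OF _ code_hom])
qed

lemma abelian_tower_level: "abelian_tower level transition"
  by (simp add: abelian_tower_def comm_group_level transition_hom)

lemma transition_epi: "transition i \<in> epi (level (Suc i)) (level i)"
  unfolding epi_iff_subset
proof (intro conjI transition_hom subsetI)
  fix x assume x: "x \<in> carrier (level i)"
  then obtain a c where ac: "x = code (a, c)"
    by (auto simp: level_def image_group_carrier)
  with x have bounds: "0 \<le> a" "a < int (p ^ i)" "c \<in> carrier C"
    by (simp_all add: code_in_level)
  moreover have "int (p ^ i) \<le> int (p ^ Suc i)"
    using p_pos by simp
  ultimately have "code (a, c) \<in> carrier (level (Suc i))"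
    by (simp add: code_in_level)
  moreover have "x = transition i (code (a, c))"
    using bounds by (simp add: ac transition_code)
  ultimately show "x \<in> transition i ` carrier (level (Suc i))" by blast
qed

lemma code_sequence_in_limit:
  assumes "\<And>i. code (a i, c) \<in> carrier (level i)" and "\<And>i. a (Suc i) mod int (p ^ i) = a i"
  shows "(\<lambda>i. code (a i, c)) \<in> carrier limit"
  using assms by (simp add: carrier_tower_lim transition_code)

lemma fst_decode_mod:
  assumes "x \<in> carrier limit"
  shows "fst (decode (x (Suc i))) mod int (p ^ i) = fst (decode (x i))"
proof -
  have "x i = transition i (x (Suc i))"
    using assms by (simp add: carrier_tower_lim)
  then have "decode (x i) = decode (transition i (x (Suc i)))"
    by (rule arg_cong)
  then show ?thesis
    by (simp add: transition_def case_prod_unfold)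
qed

lemma fst_decode_hom: "(\<lambda>x. fst (decode (x i))) \<in> hom limit (integer_mod_group (p ^ i))"
  and snd_decode_hom: "(\<lambda>x. snd (decode (x i))) \<in> hom limit C"
  using Group.hom_compose[OF tower_lim_proj_hom[of i level transition] decode_hom]
  by (simp_all add: hom_pairwise o_def)

lemma adic_part_hom: "adic_part \<in> hom limit (adic_integer_group p)"
proof (rule homI)
  fix x y assume x: "x \<in> carrier limit" and y: "y \<in> carrier limit"
  show "adic_part x \<in> carrier (adic_integer_group p)"
    using hom_in_carrier[OF fst_decode_hom x] fst_decode_mod[OF x]
    by (simp add: adic_integer_group_def carrier_tower_lim adic_part_def)
  show "adic_part (x \<otimes>\<^bsub>limit\<^esub> y) = adic_part x \<otimes>\<^bsub>adic_integer_group p\<^esub> adic_part y"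
    using hom_mult[OF fst_decode_hom x y] by (simp add: mult_adic_integer_group adic_part_def)
qed

lemma constant_part_hom: "constant_part \<in> hom limit C"
  using snd_decode_hom[of 0] by (simp add: constant_part_def[abs_def])

definition pairing :: "(nat \<Rightarrow> 'a) \<Rightarrow> (nat \<Rightarrow> 'a) \<Rightarrow> 'c"
  where "pairing x y = adic_pow C p (constant_part y) (adic_part x)"

lemma pairing_hom_left:
  assumes y: "y \<in> carrier limit"
  shows "(\<lambda>x. pairing x y) \<in> hom limit C"
proof -
  have y_in: "constant_part y \<in> carrier C"
    by (rule hom_in_carrier[OF constant_part_hom y])
  then obtain i where "constant_part y [^]\<^bsub>C\<^esub> (p ^ i) = \<one>\<^bsub>C\<^esub>"
    using primary unfolding p_primary_def by blast
  from Group.hom_compose[OF adic_part_hom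
      group.adic_pow_hom_exponent[OF comm_group.axioms(2)[OF C] p_pos y_in this]]
  show ?thesis by (simp add: pairing_def o_def)
qed

lemma pairing_hom_right:
  assumes x: "x \<in> carrier limit"
  shows "pairing x \<in> hom limit C"
  using Group.hom_compose[OF constant_part_hom
      comm_group.adic_pow_hom_base[OF C primary hom_in_carrier[OF adic_part_hom x]]]
  by (simp add: pairing_def[abs_def] o_def)

definition adic_generator :: "nat \<Rightarrow> 'a"
  where "adic_generator = (\<lambda>i. code (1 mod int (p ^ i), \<one>\<^bsub>C\<^esub>))"

definition constant_sequence :: "'c \<Rightarrow> nat \<Rightarrow> 'a"
  where "constant_sequence c = (\<lambda>i. code (0, c))"

lemma adic_generator_in_limit: "adic_generator \<in> carrier limit"
  unfolding adic_generator_def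
  using p_pos comm_groupE(2)[OF C]
  by (intro code_sequence_in_limit) (simp_all add: code_in_level mod_mod_cancel)

lemma constant_sequence_in_limit: "c \<in> carrier C \<Longrightarrow> constant_sequence c \<in> carrier limit"
  unfolding constant_sequence_def
  using p_pos by (intro code_sequence_in_limit) (simp_all add: code_in_level)

lemma adic_generator_annihilated: "adic_generator i [^]\<^bsub>level i\<^esub> (p ^ i) = \<one>\<^bsub>level i\<^esub>"
proof -
  interpret C: comm_group C by (rule C)
  have "adic_generator i \<in> carrier (level i)"
    using adic_generator_in_limit by (simp add: carrier_tower_lim)
  then show ?thesis
    by (simp add: adic_generator_def code_pow one_level)
qed

lemma constant_sequence_divisible:
  assumes "infinitely_divisible C p c"
  shows "\<exists>y \<in> carrier (level i). constant_sequence c i = y [^]\<^bsub>level i\<^esub> (p ^ i)"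
proof -
  obtain y where "y \<in> carrier C" "c = y [^]\<^bsub>C\<^esub> (p ^ i)"
    using assms unfolding infinitely_divisible_def by blast
  moreover from this have "constant_sequence y i \<in> carrier (level i)"
    using constant_sequence_in_limit by (simp add: carrier_tower_lim)
  ultimately show ?thesis
    by (intro bexI[of _ "constant_sequence y i"]) (simp_all add: constant_sequence_def code_pow)
qed

lemma pairing_adic_generator_constant_sequence:
  assumes c: "c \<in> carrier C"
  shows "pairing adic_generator (constant_sequence c) = c"
proof -
  obtain i where "c [^]\<^bsub>C\<^esub> (p ^ i) = \<one>\<^bsub>C\<^esub>"
    using c primary unfolding p_primary_def by blast
  from group.adic_pow_1[OF comm_group.axioms(2)[OF C] c this] show ?thesis
    by (simp add: pairing_def adic_part_def constant_part_def adic_generator_def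
        constant_sequence_def)
qed

lemma pairing_adic_generator_right: "pairing x adic_generator = \<one>\<^bsub>C\<^esub>"
proof -
  interpret comm_group C by (rule C)
  show ?thesis
    by (simp add: pairing_def constant_part_def adic_generator_def adic_pow_def)
qed

theorem homology_lim_kernel_level_not_cotorsion:
  assumes c: "\<And>n. infinitely_divisible C p (c n)"
    and unsolvable: "\<not> recurrence_solvable C m c"
  shows "\<not> cotorsion_group (homology_lim_kernel 2 level transition)"
proof (rule homology_lim_kernel_not_cotorsion[OF abelian_tower_level C
      pairing_hom_left pairing_hom_right adic_generator_in_limit])
  interpret C: comm_group C by (rule C)
  have c_in: "c n \<in> carrier C" for n
    by (rule infinitely_divisible_closed[OF C.group_axioms c])
  then show "constant_sequence (c n) \<in> carrier limit" for n
    by (rule constant_sequence_in_limit)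
  show "\<exists>q :: nat. adic_generator i [^]\<^bsub>level i\<^esub> q = \<one>\<^bsub>level i\<^esub> \<and>
      (\<exists>y \<in> carrier (level i). constant_sequence (c n) i = y [^]\<^bsub>level i\<^esub> q)" for n i
    using adic_generator_annihilated constant_sequence_divisible[OF c] by blast
  show "\<not> recurrence_solvable C m (\<lambda>n. pairing adic_generator (constant_sequence (c n)) \<otimes>\<^bsub>C\<^esub>
      inv\<^bsub>C\<^esub> pairing (constant_sequence (c n)) adic_generator)"
    using unsolvable c_in
    by (simp add: pairing_adic_generator_right pairing_adic_generator_constant_sequence)
qed

end


section \<open>A reduced 2-group with large first Ulm subgroup\<close>

text \<open>
  Row \<open>j\<close> is the group with generators $e_k$ and relations $2^k e_k = e_0$, $2^{j+1} e_0 = 0$,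
  embedded in a direct sum of copies of $\mathbb{Q}/\mathbb{Z}$ by letting $e_k$ be
  $(2^{-j-1-k}, 2^{-k}, \dots, 2^{-k}, 0, \dots)$ with $k$ entries $2^{-k}$; this is
  \<open>ulm_root j k\<close> below. Elements of $\mathbb{Q}/\mathbb{Z}$ are represented in $[0, 1)$.
\<close>

definition ulm_relations :: "(nat \<times> nat \<Rightarrow> rat) \<Rightarrow> bool"
  where "ulm_relations z \<longleftrightarrow> (\<forall>j. 2 ^ Suc j * z (j, 0) - z (j, 1) \<in> \<int>) \<and>
    (\<forall>j k. 2 ^ Suc k * z (j, Suc (Suc k)) - 2 ^ Suc k * z (j, Suc k) \<in> \<int>)"

definition ulm_group :: "(nat \<times> nat \<Rightarrow> rat) monoid"
  where "ulm_group = \<lparr>carrier = {z. (\<forall>q. frac (z q) = z q) \<and> finite {q. z q \<noteq> 0} \<and> ulm_relations z},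
    monoid.mult = (\<lambda>y z q. frac (y q + z q)), one = (\<lambda>q. 0)\<rparr>"

lemma carrier_ulm_group: "z \<in> carrier ulm_group \<longleftrightarrow>
    (\<forall>q. frac (z q) = z q) \<and> finite {q. z q \<noteq> 0} \<and> ulm_relations z"
  and mult_ulm_group: "y \<otimes>\<^bsub>ulm_group\<^esub> z = (\<lambda>q. frac (y q + z q))"
  and one_ulm_group: "\<one>\<^bsub>ulm_group\<^esub> = (\<lambda>q. 0)"
  by (simp_all add: ulm_group_def)

lemma ulm_relationsD:
  assumes "ulm_relations z"
  shows "2 ^ Suc j * z (j, 0) - z (j, 1) \<in> \<int>"
    and "2 ^ Suc k * z (j, Suc (Suc k)) - 2 ^ Suc k * z (j, Suc k) \<in> \<int>"
  using assms by (simp_all only: ulm_relations_def)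

lemma mult_frac_diff_mult_frac_in_Ints_iff:
  fixes x y :: "'a :: floor_ceiling"
  assumes "m \<in> \<int>" "n \<in> \<int>"
  shows "m * frac x - n * frac y \<in> \<int> \<longleftrightarrow> m * x - n * y \<in> \<int>"
proof -
  have "m * x - n * y = (m * frac x - n * frac y) + (m * of_int \<lfloor>x\<rfloor> - n * of_int \<lfloor>y\<rfloor>)"
    by (simp add: frac_def algebra_simps)
  moreover have "m * of_int \<lfloor>x\<rfloor> - n * of_int \<lfloor>y\<rfloor> \<in> \<int>"
    using assms by simp
  ultimately show ?thesis
    by (metis Ints_add Ints_diff add_diff_cancel_right')
qed

lemma ulm_relations_frac: "ulm_relations (\<lambda>q. frac (z q)) \<longleftrightarrow> ulm_relations z"
  using mult_frac_diff_mult_frac_in_Ints_iff[of "2 ^ Suc j" 1 "z (j, 0)" "z (j, 1)" for j]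
    mult_frac_diff_mult_frac_in_Ints_iff[of "2 ^ Suc k" "2 ^ Suc k" "z (j, Suc (Suc k))"
      "z (j, Suc k)" for j k]
  by (simp add: ulm_relations_def)

lemma ulm_relations_add:
  assumes "ulm_relations y" "ulm_relations z"
  shows "ulm_relations (\<lambda>q. y q + z q)"
proof -
  note sums = ulm_relationsD(1)[OF assms(1), THEN Ints_add, OF ulm_relationsD(1)[OF assms(2)]]
    ulm_relationsD(2)[OF assms(1), THEN Ints_add, OF ulm_relationsD(2)[OF assms(2)]]
  show ?thesis
    unfolding ulm_relations_def
  proof (intro conjI allI)
    fix j k
    show "2 ^ Suc j * (y (j, 0) + z (j, 0)) - (y (j, 1) + z (j, 1)) \<in> \<int>"
      using sums(1)[of j j] by (simp add: algebra_simps)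
    show "2 ^ Suc k * (y (j, Suc (Suc k)) + z (j, Suc (Suc k))) -
        2 ^ Suc k * (y (j, Suc k) + z (j, Suc k)) \<in> \<int>"
      using sums(2)[of k j k j] by (simp add: algebra_simps)
  qed
qed

lemma ulm_relations_uminus:
  assumes "ulm_relations z"
  shows "ulm_relations (\<lambda>q. - z q)"
  using ulm_relationsD[OF assms, THEN Ints_minus] by (simp add: ulm_relations_def)

lemma comm_group_ulm_group: "comm_group ulm_group"
proof (rule comm_groupI)
  fix x y z
  assume x: "x \<in> carrier ulm_group" and y: "y \<in> carrier ulm_group"
  have "finite ({q. x q \<noteq> 0} \<union> {q. y q \<noteq> 0})"
    using x y by (simp add: carrier_ulm_group)
  then have "finite {q. frac (x q + y q) \<noteq> 0}"
    by (rule finite_subset[rotated]) auto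
  with x y show "x \<otimes>\<^bsub>ulm_group\<^esub> y \<in> carrier ulm_group"
    by (simp add: carrier_ulm_group mult_ulm_group ulm_relations_frac ulm_relations_add)
  show "x \<otimes>\<^bsub>ulm_group\<^esub> y \<otimes>\<^bsub>ulm_group\<^esub> z = x \<otimes>\<^bsub>ulm_group\<^esub> (y \<otimes>\<^bsub>ulm_group\<^esub> z)"
    by (simp add: mult_ulm_group add.assoc)
  show "x \<otimes>\<^bsub>ulm_group\<^esub> y = y \<otimes>\<^bsub>ulm_group\<^esub> x"
    by (simp add: mult_ulm_group add.commute)
  show "\<one>\<^bsub>ulm_group\<^esub> \<otimes>\<^bsub>ulm_group\<^esub> x = x"
    using x by (simp add: mult_ulm_group one_ulm_group carrier_ulm_group fun_eq_iff)
  let ?y = "\<lambda>q. frac (- x q)"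
  have "finite {q. ?y q \<noteq> 0}"
    using x by (auto simp: carrier_ulm_group elim: finite_subset[rotated])
  then have "?y \<in> carrier ulm_group"
    using x by (simp add: carrier_ulm_group ulm_relations_frac ulm_relations_uminus)
  then show "\<exists>y \<in> carrier ulm_group. y \<otimes>\<^bsub>ulm_group\<^esub> x = \<one>\<^bsub>ulm_group\<^esub>"
    by (rule bexI[rotated]) (simp add: mult_ulm_group one_ulm_group)
qed (simp add: carrier_ulm_group one_ulm_group ulm_relations_def)

lemma nat_pow_ulm_group: "(z [^]\<^bsub>ulm_group\<^esub> (n :: nat)) q = frac (of_nat n * z q)"
  by (induction n) (simp_all add: nat_pow_def mult_ulm_group one_ulm_group algebra_simps)

lemma nat_pow_ulm_group_eq_one_iff:
  "z [^]\<^bsub>ulm_group\<^esub> (n :: nat) = \<one>\<^bsub>ulm_group\<^esub> \<longleftrightarrow> (\<forall>q. of_nat n * z q \<in> \<int>)"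
  by (simp add: fun_eq_iff nat_pow_ulm_group one_ulm_group)

lemma Ints_power_mult_mono:
  fixes x :: "'a :: ring_1"
  assumes "2 ^ i * x \<in> \<int>" "i \<le> k"
  shows "2 ^ k * x \<in> \<int>"
proof -
  have "2 ^ k = 2 ^ (k - i) * (2 ^ i :: 'a)"
    using assms(2) by (simp flip: power_add)
  then show ?thesis
    using assms(1) by (simp add: mult.assoc)
qed

lemma ulm_group_support_bounded:
  assumes "z \<in> carrier ulm_group"
  obtains m where "\<And>j k. m \<le> j \<or> m \<le> k \<Longrightarrow> z (j, k) = 0"
proof -
  let ?S = "{q. z q \<noteq> 0}"
  have "finite (fst ` ?S \<union> snd ` ?S)"
    using assms by (simp add: carrier_ulm_group)
  then obtain m where "\<forall>n \<in> fst ` ?S \<union> snd ` ?S. n < m"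
    unfolding finite_nat_set_iff_bounded ..
  then have bound: "fst q < m" "snd q < m" if "z q \<noteq> 0" for q
    using that by auto
  show thesis
  proof (rule that)
    show "z (j, k) = 0" if "m \<le> j \<or> m \<le> k" for j k
      using bound[of "(j, k)"] that by (cases "z (j, k) = 0") auto
  qed
qed

lemma ulm_relations_tail_torsion:
  assumes z: "ulm_relations z" and m: "\<And>k. m \<le> k \<Longrightarrow> z (j, k) = 0"
  shows "2 ^ m * z (j, Suc k) \<in> \<int>"
proof (cases "k < m")
  case True
  then have "k \<le> m" by simp
  then show ?thesis
  proof (induction k rule: inc_induct)
    case base
    show ?case by (simp add: m)
  next
    case (step k)
    have "2 ^ Suc k * (z (j, Suc (Suc k)) - z (j, Suc k)) \<in> \<int>"
      unfolding right_diff_distrib by (rule ulm_relationsD(2)[OF z])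
    then have "2 ^ m * (z (j, Suc (Suc k)) - z (j, Suc k)) \<in> \<int>"
      by (rule Ints_power_mult_mono) (use step.hyps in simp)
    from Ints_diff[OF step.IH this] show ?case
      by (simp add: right_diff_distrib)
  qed
qed (simp add: m)

lemma p_primary_ulm_group: "p_primary 2 ulm_group"
  unfolding p_primary_def
proof
  fix z assume z: "z \<in> carrier ulm_group"
  obtain m where m: "\<And>j k. m \<le> j \<or> m \<le> k \<Longrightarrow> z (j, k) = 0"
    using ulm_group_support_bounded[OF z] by blast
  have rel: "ulm_relations z"
    using z by (simp add: carrier_ulm_group)
  have tail: "2 ^ m * z (j, Suc k) \<in> \<int>" for j k
    by (rule ulm_relations_tail_torsion[OF rel]) (simp add: m)
  have "2 ^ (m + m) * z (j, k) \<in> \<int>" for j k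
  proof (cases k)
    case 0
    have "2 ^ m * (2 ^ Suc j * z (j, 0) - z (j, 1)) + 2 ^ m * z (j, 1) \<in> \<int>"
      using tail[of j 0] by (intro Ints_add[OF Ints_mult[OF _ ulm_relationsD(1)[OF rel]]]) simp_all
    then have "2 ^ (m + Suc j) * z (j, 0) \<in> \<int>"
      by (simp add: algebra_simps power_add)
    then have "2 ^ (m + m) * z (j, 0) \<in> \<int>" if "j < m"
      by (rule Ints_power_mult_mono) (use that in simp)
    then show ?thesis
      using 0 by (cases "j < m") (simp_all add: m)
  next
    case (Suc l)
    then show ?thesis
      using Ints_power_mult_mono[OF tail, of "m + m" j l] by simp
  qed
  then show "\<exists>i. z [^]\<^bsub>ulm_group\<^esub> (2 ^ i :: nat) = \<one>\<^bsub>ulm_group\<^esub>"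
    by (intro exI[of _ "m + m"]) (simp add: nat_pow_ulm_group_eq_one_iff)
qed

lemma infinitely_divisible_ulm_group_tail:
  assumes "infinitely_divisible ulm_group 2 z"
  shows "z (j, Suc k) = 0"
proof -
  have Suc_eq: "z (j, Suc (Suc k)) = z (j, Suc k)" for k
  proof -
    obtain y where y: "y \<in> carrier ulm_group" "z = y [^]\<^bsub>ulm_group\<^esub> (2 ^ Suc k :: nat)"
      using assms unfolding infinitely_divisible_def by blast
    have "2 ^ Suc k * y (j, Suc (Suc k)) - 2 ^ Suc k * y (j, Suc k) \<in> \<int>"
      using y(1) by (simp add: carrier_ulm_group ulm_relations_def)
    then have "frac (2 ^ Suc k * y (j, Suc (Suc k))) = frac (2 ^ Suc k * y (j, Suc k))"
      by (intro frac_diff_zero) simp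
    then show ?thesis by (simp add: y(2) nat_pow_ulm_group)
  qed
  have eq: "z (j, Suc k) = z (j, Suc (k + d))" for d
    by (induction d) (simp_all add: Suc_eq)
  obtain m where "\<And>j k. m \<le> j \<or> m \<le> k \<Longrightarrow> z (j, k) = 0"
    using infinitely_divisible_closed[OF comm_group.axioms(2)[OF comm_group_ulm_group] assms]
    by (rule ulm_group_support_bounded) blast
  then show ?thesis
    using eq[of m] by simp
qed

definition ulm_generator :: "nat \<Rightarrow> nat \<times> nat \<Rightarrow> rat"
  where "ulm_generator n = (\<lambda>q. if q = (n, 0) then 1 / 2 ^ Suc n else 0)"

definition ulm_root :: "nat \<Rightarrow> nat \<Rightarrow> nat \<times> nat \<Rightarrow> rat"
  where "ulm_root n i = (\<lambda>(j, k).
    if j \<noteq> n then 0 else if k = 0 then 1 / 2 ^ (Suc n + i) else if k \<le> i then 1 / 2 ^ i else 0)"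

lemma ulm_root_closed: "ulm_root n i \<in> carrier ulm_group"
proof -
  have "finite {q. ulm_root n i q \<noteq> 0}"
    by (rule finite_subset[of _ "{n} \<times> {..i}"]) (auto simp: ulm_root_def split: if_splits)
  moreover have "frac (ulm_root n i q) = ulm_root n i q" for q
    using one_less_power[of "2 :: rat" "Suc (n + i)"]
    by (cases q) (auto simp: ulm_root_def frac_eq)
  moreover have "ulm_relations (ulm_root n i)"
    by (auto simp: ulm_relations_def ulm_root_def power_add not_less_eq_eq dest: order_antisym)
  ultimately show ?thesis by (simp add: carrier_ulm_group)
qed

lemma ulm_root_pow: "ulm_root n i [^]\<^bsub>ulm_group\<^esub> (2 ^ i :: nat) = ulm_generator n"
proof
  fix q :: "nat \<times> nat"
  show "(ulm_root n i [^]\<^bsub>ulm_group\<^esub> (2 ^ i :: nat)) q = ulm_generator n q"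
    using one_less_power[of "2 :: rat" "Suc n"]
    by (cases q) (auto simp: nat_pow_ulm_group ulm_root_def ulm_generator_def frac_eq power_add)
qed

lemma infinitely_divisible_ulm_generator: "infinitely_divisible ulm_group 2 (ulm_generator n)"
  unfolding infinitely_divisible_def using ulm_root_closed ulm_root_pow by metis

lemma halving_recurrence_not_in_Ints:
  fixes a :: "nat \<Rightarrow> rat"
  assumes "a 0 \<in> \<int>" and before: "\<And>n. n < m \<Longrightarrow> a n - 2 * a (Suc n) \<in> \<int>"
    and jump: "a m - 2 * a (Suc m) - 1 / 2 ^ Suc m \<in> \<int>"
  shows "2 ^ Suc m * a (Suc m) \<notin> \<int>"
proof
  assume after: "2 ^ Suc m * a (Suc m) \<in> \<int>"
  have "2 ^ n * a n \<in> \<int>" if "n \<le> m" for n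
    using that
  proof (induction n)
    case (Suc n)
    have "2 ^ n * a n - 2 ^ n * (a n - 2 * a (Suc n)) \<in> \<int>"
      by (rule Ints_diff[OF _ Ints_mult[OF _ before]]) (use Suc in simp_all)
    then show ?case by (simp add: algebra_simps)
  qed (simp add: assms(1))
  then have "2 ^ m * a m - 2 ^ m * (a m - 2 * a (Suc m) - 1 / 2 ^ Suc m) -
      2 ^ Suc m * a (Suc m) \<in> \<int>"
    by (intro Ints_diff[OF Ints_diff[OF _ Ints_mult[OF _ jump]] after]) simp_all
  then have "1 / 2 \<in> (\<int> :: rat set)"
    by (simp add: algebra_simps)
  then show False
    by (auto elim!: Ints_cases simp: field_simps)
qed

lemma ulm_group_recurrence_unsolvable:
  "\<not> recurrence_solvable ulm_group (\<lambda>_. 2) ulm_generator"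
proof
  assume "recurrence_solvable ulm_group (\<lambda>_. 2) ulm_generator"
  then obtain x where x: "\<And>n. x n \<in> carrier ulm_group"
    and x_eq: "\<And>n. x n = x (Suc n) [^]\<^bsub>ulm_group\<^esub> (2 :: nat) \<otimes>\<^bsub>ulm_group\<^esub> ulm_generator n"
    by (rule recurrence_solvableE) blast
  have "infinitely_divisible ulm_group 2 (x n)" for n
    by (rule infinitely_divisible_if_recurrence[of _ _ ulm_generator x, OF comm_group_ulm_group
          infinitely_divisible_ulm_generator x x_eq])
  then have tail: "x n (j, Suc k) = 0" for n j k
    by (rule infinitely_divisible_ulm_group_tail)
  obtain m where m: "x 0 (m, 0) = 0"
    using ulm_group_support_bounded[OF x[of 0]] by blast
  have step: "x n (m, 0) - 2 * x (Suc n) (m, 0) - ulm_generator n (m, 0) \<in> \<int>" for n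
  proof -
    have "x n (m, 0) = frac (2 * x (Suc n) (m, 0) + ulm_generator n (m, 0))"
      by (subst x_eq) (simp add: mult_ulm_group nat_pow_ulm_group)
    then show ?thesis by (simp add: frac_def)
  qed
  have "2 ^ Suc m * x (Suc m) (m, 0) \<notin> \<int>"
  proof (rule halving_recurrence_not_in_Ints[of "\<lambda>n. x n (m, 0)" m])
    show "x n (m, 0) - 2 * x (Suc n) (m, 0) \<in> \<int>" if "n < m" for n
      using step[of n] that by (simp add: ulm_generator_def)
    show "x m (m, 0) - 2 * x (Suc m) (m, 0) - 1 / 2 ^ Suc m \<in> \<int>"
      using step[of m] by (simp add: ulm_generator_def)
  qed (simp add: m)
  moreover have "2 ^ Suc m * x (Suc m) (m, 0) \<in> \<int>"
    using x[of "Suc m"] ulm_relationsD(1)[of "x (Suc m)" m] tail[of "Suc m" m 0]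
    by (simp add: carrier_ulm_group)
  ultimately show False by contradiction
qed


section \<open>The counterexample\<close>

definition sequence_code :: "int \<times> (nat \<times> nat \<Rightarrow> rat) \<Rightarrow> nat \<Rightarrow> int"
  where "sequence_code = (\<lambda>(a, z). case_nat a (\<lambda>n. int (to_nat (z (prod_decode n)))))"

lemma inj_sequence_code: "inj sequence_code"
proof (rule injI)
  fix u v assume eq: "sequence_code u = sequence_code v"
  obtain a y b z where uv: "u = (a, y)" "v = (b, z)"
    by fastforce
  have "a = b"
    using fun_cong[OF eq, of 0] by (simp add: uv sequence_code_def)
  moreover have "y q = z q" for q
    using fun_cong[OF eq, of "Suc (prod_encode q)"] by (simp add: uv sequence_code_def)
  ultimately show "u = v" by (simp add: uv fun_eq_iff)
qed

theorem theorem1: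
  shows "\<exists>(A :: nat \<Rightarrow> (nat \<Rightarrow> int) monoid) f.
    abelian_tower A f \<and>
    (\<forall>i. f i \<in> epi (A (Suc i)) (A i)) \<and>
    \<not> cotorsion_group
      ((group_homology 2 (tower_lim A f))\<lparr>carrier :=
        kernel (group_homology 2 (tower_lim A f))
               (tower_lim (\<lambda>i. group_homology 2 (A i)) (\<lambda>i. group_homology_map 2 (A i) (f i)))
               (homology_lim_map 2 A)\<rparr>)"
proof -
  interpret cyclic_product_tower sequence_code 2 ulm_group
    by (rule cyclic_product_tower.intro)
      (simp_all add: inj_sequence_code comm_group_ulm_group p_primary_ulm_group)
  have "\<not> cotorsion_group (homology_lim_kernel 2 level transition)"
    by (rule homology_lim_kernel_level_not_cotorsion[OF infinitely_divisible_ulm_generator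
          ulm_group_recurrence_unsolvable])
  then show ?thesis
    unfolding homology_lim_kernel_def using abelian_tower_level transition_epi by blast
qed

end
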